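(* Let $T$ be a reduced ring with $|T|=2^{2^{\aleph_0}}$. Then either $T$ has a maximal subring, or $|\mathrm{Max}(T)|=2^{\aleph_0}$ and the intersection of each countable family of maximal ideals of $T$ is nonzero.
   Context: All rings are commutative with $1\neq0$ and subrings are unital. A maximal subring of $T$ is a proper subring maximal with respect to inclusion among proper subrings of $T$. $\mathrm{Max}(T)$ denotes the set of maximal ideals of $T$. *)

theory Defs
  imports "HOL-Algebra.Algebra" "HOL-Library.Equipollence"
begin

definition reduced_ring :: "('a, 'b) ring_scheme \<Rightarrow> bool" where
  "reduced_ring R \<longleftrightarrow> (\<forall>x\<in>carrier R. \<forall>n::nat. x [^]\<^bsub>R\<^esub> n = \<zero>\<^bsub>R\<^esub> \<longrightarrow> x = \<zero>\<^bsub>R\<^esub>)"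

definition maximal_subring :: "'a set \<Rightarrow> ('a, 'b) ring_scheme \<Rightarrow> bool" where
  "maximal_subring S R \<longleftrightarrow> subring S R \<and> S \<noteq> carrier R \<and>
     (\<forall>S'. subring S' R \<and> S \<subseteq> S' \<and> S' \<noteq> carrier R \<longrightarrow> S' = S)"

definition Max_ideals :: "('a, 'b) ring_scheme \<Rightarrow> 'a set set" where
  "Max_ideals R = {I. maximalideal I R}"

end

theory Submission
  imports Defs "HOL-Library.Countable_Set" "HOL-Computational_Algebra.Primes"
begin

text \<open>Suppose T, and hence every quotient of T, has no maximal subring. In a domain with a unit x
  transcendental over its prime ring, let K be maximal among the subrings over which x is
  transcendental; the trace of a valuation ring dominating K[1/x] at 1/x is proper and together
  with x generates the whole ring, so a maximal subring exists. The same argument with a prime number in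
  place of 1/x handles characteristic 0. Consequently the residue fields of T are countable and
  their nonzero elements are roots of unity, and T is a Hilbert ring.
  Two different maximal ideals have nonisomorphic residue fields, since otherwise the preimage of
  the diagonal of their product is a maximal subring; so there are at most continuum many maximal ideals.
  If countably many of them had zero intersection, T would embed into a countable product of
  countable sets and be too small.

  For the lower bound call a closed set V(I) of maximal ideals small if the functions on it induced by T are
  at most continuum many. For every t the set V(I) is the countable union of its intersections with V(t) and
  the sets V(t^n - 1), and each V(t^n - 1) is comaximal with V(t). This is used to show that
  a set V(I) which is not small contains two such sets with comaximal ideals. As the whole
  spectrum is not small, iteration gives a Cantor tree and continuum many maximal ideals.\<close>

section \<open>Subrings avoiding the inverse of a uniformizer\<close>

text \<open>No valuation ring is constructed. A subring V that is maximal for containing none of the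
  products \<open>c \<otimes> x\<close> with c in C already supplies what a valuation would: factors
  of valuation 0 cancel, and a root of a polynomial over V lies in V after multiplication by the
  leading coefficient. Everything stays inside the given ring, where members of C need not be
  invertible; hence all multiples \<open>c \<otimes> x\<close> are avoided and not x alone. The sets
  V(t^n - 1) stand in for the complement of V(t), which need not be closed. A set that cannot be
  split behaves like a single point N: off N everything is small. Counting the functions on such a
  set requires listing finitely many maximal ideals inside a code, so the upper bound on the number
  of maximal ideals is an ingredient of the lower bound. Cardinalities are handled by maps into sets
  of natural numbers: such a set is the universal code for "at most continuum many".\<close>

lemma (in ring) subring_Union_chain:
  assumes "subset.chain {S. subring S R} \<C>" and "\<C> \<noteq> {}"
  shows "subring (\<Union>\<C>) R"
proof -
  have sub: "subring S R" if "S \<in> \<C>" for S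
    using assms(1) that by (auto simp: subset_chain_def)
  have two: "\<exists>S\<in>\<C>. a \<in> S \<and> b \<in> S" if "a \<in> \<Union>\<C>" "b \<in> \<Union>\<C>" for a b
    using assms(1) that unfolding subset_chain_def by blast
  show ?thesis
  proof (rule subringI)
    show "\<Union>\<C> \<subseteq> carrier R" using sub subringE(1) by blast
    show "\<one> \<in> \<Union>\<C>" using assms(2) sub subringE(3) by blast
    show "\<ominus> h \<in> \<Union>\<C>" if "h \<in> \<Union>\<C>" for h using that subringE(5)[OF sub] by blast
    show "h1 \<otimes> h2 \<in> \<Union>\<C>" if "h1 \<in> \<Union>\<C>" "h2 \<in> \<Union>\<C>" for h1 h2
      using two[OF that] subringE(6)[OF sub] by blast
    show "h1 \<oplus> h2 \<in> \<Union>\<C>" if "h1 \<in> \<Union>\<C>" "h2 \<in> \<Union>\<C>" for h1 h2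
      using two[OF that] subringE(7)[OF sub] by blast
  qed
qed

lemma (in ring) exists_maximal_subring_with:
  assumes "subring A R" and "P A"
    and fin: "\<And>\<C>. subset.chain {S. subring S R \<and> P S} \<C> \<Longrightarrow> \<C> \<noteq> {} \<Longrightarrow> P (\<Union>\<C>)"
  obtains V where "subring V R" "A \<subseteq> V" "P V"
    "\<And>W. subring W R \<Longrightarrow> V \<subseteq> W \<Longrightarrow> P W \<Longrightarrow> W = V"
proof -
  let ?SS = "{S. subring S R \<and> P S \<and> A \<subseteq> S}"
  have "\<exists>M \<in> ?SS. \<forall>W \<in> ?SS. M \<subseteq> W \<longrightarrow> W = M"
  proof (rule subset_Zorn_nonempty)
    show "?SS \<noteq> {}" using assms(1,2) by blast
    fix \<C> assume "\<C> \<noteq> {}" and ch: "subset.chain ?SS \<C>"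
    have "subset.chain {S. subring S R \<and> P S} \<C>" "subset.chain {S. subring S R} \<C>"
      using ch by (auto simp: subset_chain_def)
    then have "subring (\<Union>\<C>) R" "P (\<Union>\<C>)"
      using \<open>\<C> \<noteq> {}\<close> fin subring_Union_chain by blast+
    moreover have "A \<subseteq> \<Union>\<C>"
      using ch \<open>\<C> \<noteq> {}\<close> unfolding subset_chain_def by blast
    ultimately show "\<Union>\<C> \<in> ?SS" by blast
  qed
  then obtain M where "M \<in> ?SS" "\<forall>W \<in> ?SS. M \<subseteq> W \<longrightarrow> W = M" ..
  then show thesis using that[of M] by blast
qed

lemma (in ring) exists_maximal_subring_avoiding:
  assumes "subring A R" and "A \<inter> B = {}"
  obtains V where "subring V R" "A \<subseteq> V" "V \<inter> B = {}"
    "\<And>W. subring W R \<Longrightarrow> V \<subseteq> W \<Longrightarrow> W \<inter> B = {} \<Longrightarrow> W = V"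
proof (rule exists_maximal_subring_with[OF assms(1), of "\<lambda>S. S \<inter> B = {}"])
  show "A \<inter> B = {}" by fact
  show "\<Union>\<C> \<inter> B = {}" if "subset.chain {S. subring S R \<and> S \<inter> B = {}} \<C>" for \<C>
    using that by (auto simp: subset_chain_def)
qed (use that in blast)

text \<open>Among the subrings above S, missing x and being proper are the same thing, because S and
  x generate R. So a subring that is maximal for missing x, which Zorn's lemma provides, is a
  maximal subring.\<close>

lemma (in ring) maximal_subring_if_simple_over:
  assumes "subring S R" and "x \<in> carrier R" and "x \<notin> S"
    and gen: "\<And>W. subring W R \<Longrightarrow> S \<subseteq> W \<Longrightarrow> x \<in> W \<Longrightarrow> W = carrier R"
  shows "\<exists>V. maximal_subring V R"
proof -
  obtain V where V: "subring V R" "S \<subseteq> V" "V \<inter> {x} = {}"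
    "\<And>W. subring W R \<Longrightarrow> V \<subseteq> W \<Longrightarrow> W \<inter> {x} = {} \<Longrightarrow> W = V"
    using exists_maximal_subring_avoiding[OF assms(1), of "{x}"] assms(3) by auto
  have "W = V" if W: "subring W R" "V \<subseteq> W" "W \<noteq> carrier R" for W
  proof (rule V(4)[OF W(1,2)])
    show "W \<inter> {x} = {}" using gen[OF W(1)] V(2) W by auto
  qed
  then show ?thesis
    using V assms(2) unfolding maximal_subring_def by blast
qed

section \<open>Modules spanned by the first powers of an element\<close>

locale cring_subring = cring R for R (structure) +
  fixes V :: "'a set"
  assumes V_subring: "subring V R"
begin

lemmas V_closed [simp] = subringE(2,3,5-7)[OF V_subring]

lemma V_carr [simp]: "v \<in> V \<Longrightarrow> v \<in> carrier R"
  using subringE(1)[OF V_subring] by blast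

lemma V_pow [simp]: "v \<in> V \<Longrightarrow> v [^] (n::nat) \<in> V"
  by (induct n) auto

lemma V_minus [simp]: "u \<in> V \<Longrightarrow> v \<in> V \<Longrightarrow> u \<ominus> v \<in> V"
  by (simp add: minus_eq)

text \<open>The V-module spanned by 1, t, ..., t^(k-1). The highest power is kept apart because the
  Nakayama argument removes generators from the top.\<close>

primrec pspan :: "'a \<Rightarrow> nat \<Rightarrow> 'a set" where
  "pspan t 0 = {\<zero>}"
| "pspan t (Suc k) = {f \<oplus> v \<otimes> t [^] k | f v. f \<in> pspan t k \<and> v \<in> V}"

context fixes t assumes t_in [simp]: "t \<in> carrier R"
begin

lemma pspan_carr: "f \<in> pspan t k \<Longrightarrow> f \<in> carrier R"
  by (induct k arbitrary: f) auto

lemma pspan_SucI: "f \<in> pspan t k \<Longrightarrow> v \<in> V \<Longrightarrow> f \<oplus> v \<otimes> t [^] k \<in> pspan t (Suc k)"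
  by auto

lemma pspan_zero: "\<zero> \<in> pspan t k"
proof (induct k)
  case (Suc k)
  then show ?case using pspan_SucI[OF Suc, of \<zero>] by simp
qed simp

lemma pspan_Suc_mono: "f \<in> pspan t k \<Longrightarrow> f \<in> pspan t (Suc k)"
  using pspan_SucI[of f k \<zero>] pspan_carr by simp

lemma pspan_mono: "f \<in> pspan t k \<Longrightarrow> k \<le> l \<Longrightarrow> f \<in> pspan t l"
  by (rule lift_Suc_mono_le[of "pspan t", THEN subsetD]) (use pspan_Suc_mono in blast)+

lemma pspan_pow: "k < n \<Longrightarrow> v \<in> V \<Longrightarrow> v \<otimes> t [^] k \<in> pspan t n"
  using pspan_SucI[OF pspan_zero, of v k] pspan_mono[of _ "Suc k" n] by simp

lemma pspan_add: "f \<in> pspan t k \<Longrightarrow> g \<in> pspan t k \<Longrightarrow> f \<oplus> g \<in> pspan t k"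
proof (induct k arbitrary: f g)
  case (Suc k)
  obtain f' v g' w where *: "f' \<in> pspan t k" "v \<in> V" "f = f' \<oplus> v \<otimes> t [^] k"
    "g' \<in> pspan t k" "w \<in> V" "g = g' \<oplus> w \<otimes> t [^] k"
    using Suc(2,3) by auto
  have "f \<oplus> g = (f' \<oplus> g') \<oplus> (v \<oplus> w) \<otimes> t [^] k"
    using * pspan_carr by (simp add: l_distr a_ac)
  then show ?case using Suc(1)[OF *(1,4)] * by (metis V_closed(5) pspan_SucI)
qed simp

lemma pspan_smult: "f \<in> pspan t k \<Longrightarrow> v \<in> V \<Longrightarrow> v \<otimes> f \<in> pspan t k"
proof (induct k arbitrary: f)
  case (Suc k)
  obtain f' w where *: "f' \<in> pspan t k" "w \<in> V" "f = f' \<oplus> w \<otimes> t [^] k"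
    using Suc(2) by auto
  have "v \<otimes> f = v \<otimes> f' \<oplus> (v \<otimes> w) \<otimes> t [^] k"
    using * Suc(3) pspan_carr by (simp add: r_distr m_assoc)
  then show ?case using Suc(1)[OF *(1) Suc(3)] * Suc(3) by (metis V_closed(4) pspan_SucI)
qed simp

lemma pspan_minus: "f \<in> pspan t k \<Longrightarrow> \<ominus> f \<in> pspan t k"
  using pspan_smult[of f k "\<ominus> \<one>"] pspan_carr by (simp add: l_minus)

lemma pspan_shift: "f \<in> pspan t k \<Longrightarrow> t \<otimes> f \<in> pspan t (Suc k)"
proof (induct k arbitrary: f)
  case (Suc k)
  obtain f' w where *: "f' \<in> pspan t k" "w \<in> V" "f = f' \<oplus> w \<otimes> t [^] k"
    using Suc(2) by auto
  have "t \<otimes> f = t \<otimes> f' \<oplus> w \<otimes> t [^] Suc k"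
    using * pspan_carr by (simp add: r_distr m_ac)
  then show ?case using pspan_SucI[OF Suc(1)[OF *(1)] *(2)] by simp
qed (use pspan_zero[of "Suc 0"] in simp)

lemma eval_in_pspan: "set p \<subseteq> V \<Longrightarrow> eval p t \<in> pspan t (length p)"
proof (induct p)
  case (Cons a p)
  then have "eval p t \<oplus> a \<otimes> t [^] length p \<in> pspan t (length (a # p))"
    using pspan_SucI[of "eval p t" "length p" a] by simp
  then show ?case using Cons pspan_carr by (simp add: a_comm)
qed simp

lemma pspan_top:
  assumes "a \<in> V" "set p \<subseteq> V" "length p = Suc m" "eval (a # p) t = \<zero>"
  shows "a \<otimes> t [^] Suc m \<in> pspan t (Suc m)"
proof -
  have ev: "eval p t \<in> pspan t (Suc m)" using eval_in_pspan[OF assms(2)] assms(3) by simp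
  have "a \<otimes> t [^] Suc m \<oplus> eval p t = \<zero>" using assms(3,4) by simp
  then have "a \<otimes> t [^] Suc m = \<ominus> eval p t"
    using ev pspan_carr assms(1) by (intro sum_zero_eq_neg) auto
  then show ?thesis using pspan_minus[OF ev] by simp
qed

text \<open>Multiplication by \<open>a \<otimes> t\<close> shifts every power by one; only t^m
  leaves the span, and \<open>top\<close> brings a t^(m+1) back into it. This is the integrality of
  \<open>a \<otimes> t\<close> over V, expressed without polynomials.\<close>

lemma pspan_mult_closed:
  assumes a: "a \<in> V" and top: "a \<otimes> t [^] Suc m \<in> pspan t (Suc m)" and f: "f \<in> pspan t (Suc m)"
  shows "a \<otimes> t \<otimes> f \<in> pspan t (Suc m)"
proof -
  obtain g v where g: "g \<in> pspan t m" "v \<in> V" "f = g \<oplus> v \<otimes> t [^] m" using f by auto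
  have c: "g \<in> carrier R" "v \<in> carrier R" "a \<in> carrier R" using g a pspan_carr by auto
  have "a \<otimes> t \<otimes> f = a \<otimes> (t \<otimes> g) \<oplus> v \<otimes> (a \<otimes> t [^] Suc m)"
    using g(3) c by (simp add: r_distr m_ac)
  moreover have "a \<otimes> (t \<otimes> g) \<in> pspan t (Suc m)" using pspan_shift[OF g(1)] pspan_smult a by blast
  moreover have "v \<otimes> (a \<otimes> t [^] Suc m) \<in> pspan t (Suc m)" using pspan_smult[OF top] g(2) by blast
  ultimately show ?thesis using pspan_add by presburger
qed

lemma finite_pspan: "finite V \<Longrightarrow> finite (pspan t k)"
proof (induct k)
  case (Suc k)
  have "pspan t (Suc k) = (\<lambda>(f, v). f \<oplus> v \<otimes> t [^] k) ` (pspan t k \<times> V)" by auto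
  then show ?case using Suc by simp
qed simp

end

end

text \<open>In the intended situation V is the trace on R of a rank one valuation ring with uniformizer y,
  and C consists of elements of valuation 0.\<close>

locale saturated_subring = cring_subring +
  fixes C :: "'a set" and x y :: 'a
  assumes y_in: "y \<in> V" and x_in: "x \<in> carrier R" and xy: "x \<otimes> y = \<one>"
    and C_sub: "C \<subseteq> V" and C_one: "\<one> \<in> C"
    and C_mult: "\<And>c d. c \<in> C \<Longrightarrow> d \<in> C \<Longrightarrow> c \<otimes> d \<in> C"
    and avoid: "\<And>c. c \<in> C \<Longrightarrow> c \<otimes> x \<notin> V"
    and V_max: "\<And>W. subring W R \<Longrightarrow> V \<subseteq> W \<Longrightarrow> (\<And>c. c \<in> C \<Longrightarrow> c \<otimes> x \<notin> W) \<Longrightarrow> W = V"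
begin

lemma C_carr [simp]: "c \<in> C \<Longrightarrow> c \<in> carrier R"
  using C_sub by auto

lemmas basics [simp] = y_in x_in

text \<open>The elements of V congruent to a member of C modulo y V. They have valuation 0 in the
  intended valuation and act as the cancellable factors.\<close>

definition E where "E = {c \<oplus> y \<otimes> b | c b. c \<in> C \<and> b \<in> V}"

lemma EI: "c \<in> C \<Longrightarrow> b \<in> V \<Longrightarrow> c \<oplus> y \<otimes> b \<in> E"
  unfolding E_def by blast

lemma EE:
  assumes "e \<in> E" obtains c b where "c \<in> C" "b \<in> V" "e = c \<oplus> y \<otimes> b"
  using assms unfolding E_def by blast

lemma E_sub: "e \<in> E \<Longrightarrow> e \<in> V"
  using C_sub by (auto elim!: EE)

lemma C_sub_E: "c \<in> C \<Longrightarrow> c \<in> E"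
  using EI[of c \<zero>] by simp

lemma E_mult:
  assumes "e \<in> E" "f \<in> E" shows "e \<otimes> f \<in> E"
proof -
  obtain c b d a where *: "c \<in> C" "b \<in> V" "e = c \<oplus> y \<otimes> b" "d \<in> C" "a \<in> V" "f = d \<oplus> y \<otimes> a"
    using assms by (auto elim!: EE)
  then have "c \<in> V" "d \<in> V" using C_sub by auto
  have carr: "a \<in> carrier R" "b \<in> carrier R" "c \<in> carrier R" "d \<in> carrier R" "y \<in> carrier R"
    using * by auto
  have "e \<otimes> f = c \<otimes> d \<oplus> y \<otimes> (c \<otimes> a \<oplus> b \<otimes> d \<oplus> y \<otimes> (b \<otimes> a))"
    unfolding *(3,6) using carr by algebra
  moreover have "c \<otimes> a \<oplus> b \<otimes> d \<oplus> y \<otimes> (b \<otimes> a) \<in> V" using * \<open>c \<in> V\<close> \<open>d \<in> V\<close> by simp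
  ultimately show ?thesis using * C_mult EI by simp
qed

lemma E_pow: "e \<in> E \<Longrightarrow> e [^] (n::nat) \<in> E"
  by (induct n) (auto simp: C_one C_sub_E E_mult)

lemma E_minus:
  assumes "e \<in> E" "v \<in> V" shows "e \<ominus> y \<otimes> v \<in> E"
proof -
  obtain c b where *: "c \<in> C" "b \<in> V" "e = c \<oplus> y \<otimes> b" using assms(1) by (elim EE)
  have "c \<in> carrier R" "b \<in> carrier R" "v \<in> carrier R" "y \<in> carrier R" using * assms by auto
  then have "e \<ominus> y \<otimes> v = c \<oplus> y \<otimes> (b \<ominus> v)" using *(3) by algebra
  then show ?thesis using * assms EI by simp
qed

text \<open>As x is inverse to y, the product of \<open>c \<oplus> y \<otimes> b\<close> with x is
  \<open>c \<otimes> x \<oplus> b\<close>, and b lies in V.\<close>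

lemma E_avoid:
  assumes "e \<in> E" shows "e \<otimes> x \<notin> V"
proof
  assume a: "e \<otimes> x \<in> V"
  obtain c b where *: "c \<in> C" "b \<in> V" "e = c \<oplus> y \<otimes> b" using assms by (elim EE)
  have carr: "c \<in> carrier R" "b \<in> carrier R" "y \<in> carrier R" "x \<in> carrier R" using * by auto
  have "c \<otimes> x = e \<otimes> x \<ominus> b \<otimes> (x \<otimes> y)" using *(3) carr by algebra
  then have "c \<otimes> x = e \<otimes> x \<ominus> b" using xy carr by simp
  then have "c \<otimes> x \<in> V" using a *(2) by simp
  then show False using avoid *(1) by blast
qed

lemma meets_if_larger:
  assumes "subring W R" "V \<subseteq> W" "t \<in> W" "t \<notin> V"
  obtains c where "c \<in> C" "c \<otimes> x \<in> W"
  using V_max[OF assms(1,2)] assms(3,4) by blast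

text \<open>The elements carried into V by some power of e form a subring above V. If it were larger
  than V, it would contain some \<open>c \<otimes> x\<close>; then e^n c x would lie in V although
  e^n c belongs to \<open>E\<close>.\<close>

lemma E_cancel:
  assumes e: "e \<in> E" and t: "t \<in> carrier R" and et: "e \<otimes> t \<in> V"
  shows "t \<in> V"
proof (rule ccontr)
  assume "t \<notin> V"
  define W where "W = {w \<in> carrier R. \<exists>n::nat. e [^] n \<otimes> w \<in> V}"
  have eV [simp]: "e \<in> V" and ec [simp]: "e \<in> carrier R" using e E_sub by auto
  have mono: "e [^] (n + k) \<otimes> w \<in> V" if "e [^] n \<otimes> w \<in> V" "w \<in> carrier R" for n k :: nat and w
  proof -
    have "e [^] (n + k) \<otimes> w = e [^] k \<otimes> (e [^] n \<otimes> w)"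
      using that by (simp add: nat_pow_mult[symmetric] m_ac)
    then show ?thesis using that by simp
  qed
  have "subring W R"
  proof (rule subringI)
    show "W \<subseteq> carrier R" unfolding W_def by blast
    show "\<one> \<in> W" unfolding W_def by (auto intro!: exI[of _ "0::nat"])
    fix h assume h: "h \<in> W"
    then obtain n :: nat where n: "h \<in> carrier R" "e [^] n \<otimes> h \<in> V" unfolding W_def by blast
    then have "e [^] n \<otimes> (\<ominus> h) \<in> V" by (simp add: r_minus)
    then show "\<ominus> h \<in> W" using n unfolding W_def by blast
    fix k assume "k \<in> W"
    then obtain m :: nat where m: "k \<in> carrier R" "e [^] m \<otimes> k \<in> V" unfolding W_def by blast
    have "e [^] (n + m) \<otimes> (h \<otimes> k) = (e [^] n \<otimes> h) \<otimes> (e [^] m \<otimes> k)"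
      using n m by (simp add: nat_pow_mult[symmetric] m_ac)
    then show "h \<otimes> k \<in> W" using n m unfolding W_def by (auto intro!: exI[of _ "n + m"])
    have "e [^] (n + m) \<otimes> (h \<oplus> k) = e [^] (n + m) \<otimes> h \<oplus> e [^] (m + n) \<otimes> k"
      using n m by (simp add: r_distr add.commute)
    then have "e [^] (n + m) \<otimes> (h \<oplus> k) \<in> V" using n m mono by simp
    then show "h \<oplus> k \<in> W" using n m unfolding W_def by blast
  qed
  moreover have "V \<subseteq> W" unfolding W_def by (auto intro!: exI[of _ "0::nat"])
  moreover have "t \<in> W" using et t unfolding W_def by (auto intro!: exI[of _ "1::nat"])
  ultimately obtain c where c: "c \<in> C" "c \<otimes> x \<in> W"
    using \<open>t \<notin> V\<close> by (elim meets_if_larger)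
  then obtain n :: nat where "e [^] n \<otimes> (c \<otimes> x) \<in> V" unfolding W_def by blast
  then have "(e [^] n \<otimes> c) \<otimes> x \<in> V" using c by (simp add: m_assoc)
  moreover have "e [^] n \<otimes> c \<in> E" using E_mult E_pow e C_sub_E c by blast
  ultimately show False using E_avoid by blast
qed

context fixes t assumes t_in [simp]: "t \<in> carrier R"
begin

text \<open>Nakayama by elimination of the top generator.\<close>

lemma pspan_eliminate:
  assumes e: "e \<in> E" and k: "k \<ge> 1"
    and sub: "\<And>f. f \<in> pspan t k \<Longrightarrow> \<exists>g\<in>pspan t k. e \<otimes> f = y \<otimes> g"
  shows False
  using assms
proof (induct k arbitrary: e)
  case (Suc k)
  have ec [simp]: "e \<in> carrier R" using Suc(2) E_sub by auto
  have yc [simp]: "y \<in> carrier R" by simp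
  show False
  proof (cases "k = 0")
    case True
    have "\<one> \<in> pspan t (Suc k)" using pspan_pow[OF t_in, of 0 "Suc k" \<one>] by (simp del: pspan.simps)
    from Suc(4)[OF this] True obtain v where v: "v \<in> V" "e \<otimes> \<one> = y \<otimes> v" by auto
    then have "e \<otimes> x = v" using xy
      by (metis V_carr ec l_one m_assoc m_comm r_one x_in yc)
    then show False using v E_avoid[OF Suc(2)] by simp
  next
    case False
    have "t [^] k \<in> pspan t (Suc k)" using pspan_pow[OF t_in, of k "Suc k" \<one>] by (simp del: pspan.simps)
    from Suc(4)[OF this] obtain f v where
      f: "f \<in> pspan t k" "v \<in> V" "e \<otimes> t [^] k = y \<otimes> (f \<oplus> v \<otimes> t [^] k)" by auto
    \<comment> \<open>Moving the top term to the left expresses d t^k through lower powers.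
      Subtracting a multiple of y keeps the multiplier in \<open>E\<close>.\<close>
    define d where "d = e \<ominus> y \<otimes> v"
    have d: "d \<in> E" unfolding d_def using E_minus Suc(2) f(2) by blast
    have dV: "d \<in> V" and dc: "d \<in> carrier R" using d E_sub by auto
    have fc: "f \<in> carrier R" and vc: "v \<in> carrier R" and tc: "t [^] k \<in> carrier R"
      using f pspan_carr[OF t_in] by auto
    have dt: "d \<otimes> t [^] k = y \<otimes> f"
    proof -
      have "d \<otimes> t [^] k = e \<otimes> t [^] k \<ominus> y \<otimes> v \<otimes> t [^] k"
        unfolding d_def using fc vc tc ec yc by algebra
      also have "\<dots> = y \<otimes> f"
        unfolding f(3) using fc vc tc ec yc by algebra
      finally show ?thesis .
    qed
    \<comment> \<open>The extra factor d makes it possible to replace d t^k by y f, so that the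
      relations involve only the first k generators.\<close>
    show False
    proof (rule Suc(1)[of "d \<otimes> e"])
      show "d \<otimes> e \<in> E" using d Suc(2) E_mult by blast
      show "1 \<le> k" using False by simp
      fix g assume g: "g \<in> pspan t k"
      from Suc(4)[OF pspan_Suc_mono[OF t_in g]] obtain f' v' where
        f': "f' \<in> pspan t k" "v' \<in> V" "e \<otimes> g = y \<otimes> (f' \<oplus> v' \<otimes> t [^] k)" by auto
      have c: "g \<in> carrier R" "f' \<in> carrier R" "v' \<in> carrier R" using g f' pspan_carr[OF t_in] by auto
      have "d \<otimes> e \<otimes> g = d \<otimes> (y \<otimes> (f' \<oplus> v' \<otimes> t [^] k))"
        using f'(3) c dc by (simp add: m_assoc)
      also have "\<dots> = y \<otimes> (d \<otimes> f' \<oplus> v' \<otimes> (d \<otimes> t [^] k))"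
        using c dc tc yc by algebra
      also have "\<dots> = y \<otimes> (d \<otimes> f' \<oplus> (v' \<otimes> y) \<otimes> f)"
        unfolding dt using c fc yc by (simp add: m_assoc)
      finally have "d \<otimes> e \<otimes> g = y \<otimes> (d \<otimes> f' \<oplus> (v' \<otimes> y) \<otimes> f)" .
      moreover have "d \<otimes> f' \<oplus> (v' \<otimes> y) \<otimes> f \<in> pspan t k"
        using f f' dV by (intro pspan_add[OF t_in] pspan_smult[OF t_in]) auto
      ultimately show "\<exists>h\<in>pspan t k. d \<otimes> e \<otimes> g = y \<otimes> h" by blast
    qed
  qed
qed simp

text \<open>The multipliers of the span of 1, ..., t^m form a subring containing V and
  \<open>a \<otimes> t\<close>. If it were larger than V, it would contain some
  \<open>c \<otimes> x\<close>; then c would map the span into y times itself, which the elimination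
  forbids.\<close>

lemma leading_coeff_mult_in:
  assumes a: "a \<in> V" and p: "set p \<subseteq> V" "p \<noteq> []" and root: "eval (a # p) t = \<zero>"
  shows "a \<otimes> t \<in> V"
proof (rule ccontr)
  assume notin: "a \<otimes> t \<notin> V"
  obtain m where m: "length p = Suc m" using p(2) by (cases p) auto
  let ?F = "pspan t (Suc m)"
  have ac [simp]: "a \<in> carrier R" using a by simp
  have top: "a \<otimes> t [^] Suc m \<in> ?F" by (rule pspan_top[OF t_in a p(1) m root])
  define W where "W = {w \<in> carrier R. \<forall>f\<in>?F. w \<otimes> f \<in> ?F}"
  have "subring W R"
  proof (rule subringI)
    show "W \<subseteq> carrier R" unfolding W_def by blast
    show "\<one> \<in> W" unfolding W_def using pspan_carr[OF t_in, of _ "Suc m"] by (simp del: pspan.simps)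
    fix h assume h: "h \<in> W"
    have "\<ominus> h \<otimes> f \<in> ?F" if "f \<in> ?F" for f
      using h that pspan_minus[OF t_in, of "h \<otimes> f"] pspan_carr[OF t_in] unfolding W_def
      by (auto simp: l_minus simp del: pspan.simps)
    then show "\<ominus> h \<in> W" using h unfolding W_def by (simp del: pspan.simps)
    fix k assume k: "k \<in> W"
    have "h \<otimes> k \<otimes> f \<in> ?F" if "f \<in> ?F" for f
      using h k that pspan_carr[OF t_in that] unfolding W_def by (auto simp: m_assoc simp del: pspan.simps)
    then show "h \<otimes> k \<in> W" using h k unfolding W_def by (simp del: pspan.simps)
    have "(h \<oplus> k) \<otimes> f \<in> ?F" if "f \<in> ?F" for f
      using h k that pspan_carr[OF t_in that] pspan_add[OF t_in] unfolding W_def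
      by (auto simp: l_distr simp del: pspan.simps)
    then show "h \<oplus> k \<in> W" using h k unfolding W_def by (simp del: pspan.simps)
  qed
  moreover have "V \<subseteq> W" unfolding W_def using pspan_smult[OF t_in, of _ "Suc m"] by (auto simp del: pspan.simps)
  moreover have "a \<otimes> t \<in> W"
  proof -
    have "a \<otimes> t \<otimes> f \<in> ?F" if "f \<in> ?F" for f by (rule pspan_mult_closed[OF t_in a top that])
    then show ?thesis unfolding W_def by (simp del: pspan.simps)
  qed
  ultimately obtain c where c: "c \<in> C" "c \<otimes> x \<in> W" using notin by (elim meets_if_larger)
  show False
  proof (rule pspan_eliminate[of c "Suc m"])
    show "c \<in> E" using c C_sub_E by blast
    show "1 \<le> Suc m" by simp
    fix f assume f: "f \<in> ?F"
    then have fc: "f \<in> carrier R" and cf: "c \<otimes> x \<otimes> f \<in> ?F" using pspan_carr[OF t_in, of f "Suc m"] c unfolding W_def by (auto simp del: pspan.simps)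
    have "y \<otimes> (c \<otimes> x \<otimes> f) = (x \<otimes> y) \<otimes> (c \<otimes> f)"
      using fc c by (simp add: m_ac)
    then have "c \<otimes> f = y \<otimes> (c \<otimes> x \<otimes> f)" using xy fc c by simp
    then show "\<exists>g\<in>?F. c \<otimes> f = y \<otimes> g" using cf by blast
  qed
qed

text \<open>The form in which algebraic relations are used: of a leading coefficient split into a
  power of y and a factor of valuation 0, only the power of y remains.\<close>

lemma power_mult_in:
  assumes p: "set p \<subseteq> V" "p \<noteq> []" and e: "e \<in> E"
    and root: "eval ((y [^] (m::nat) \<otimes> e) # p) t = \<zero>"
  shows "y [^] m \<otimes> t \<in> V"
proof -
  have ec: "e \<in> carrier R" "e \<in> V" using e E_sub by auto
  have "y [^] m \<otimes> e \<otimes> t \<in> V" using leading_coeff_mult_in[OF _ p root] ec by simp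
  then have "e \<otimes> (y [^] m \<otimes> t) \<in> V" using ec by (simp add: m_ac)
  then show ?thesis using E_cancel[OF e] by simp
qed

end

text \<open>Multiplying y^n t by x^n recovers t, so V and x generate R, while x itself is avoided by
  V.\<close>

lemma maximal_subring_if_absorbing:
  assumes "\<And>t. t \<in> carrier R \<Longrightarrow> \<exists>n::nat. y [^] n \<otimes> t \<in> V"
  shows "\<exists>S. maximal_subring S R"
proof (rule maximal_subring_if_simple_over[OF V_subring x_in])
  show "x \<notin> V" using avoid[OF C_one] by simp
  fix W assume W: "subring W R" "V \<subseteq> W" "x \<in> W"
  have "t \<in> W" if t: "t \<in> carrier R" for t
  proof -
    obtain n :: nat where n: "y [^] n \<otimes> t \<in> V" using assms t by blast
    have "x [^] n \<in> W" using subringE(3,6)[OF W(1)] W(3) by (induct n) auto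
    then have "x [^] n \<otimes> (y [^] n \<otimes> t) \<in> W" using n W(2) subringE(6)[OF W(1)] by blast
    moreover have "x [^] n \<otimes> (y [^] n \<otimes> t) = (x \<otimes> y) [^] n \<otimes> t"
      using t by (simp add: nat_pow_distrib m_assoc)
    ultimately show ?thesis using xy t by simp
  qed
  then show "W = carrier R" using subringE(1)[OF W(1)] by blast
qed

end

lemma (in cring) exists_saturated_subring:
  assumes "subring A R" "y \<in> A" "x \<in> carrier R" "x \<otimes> y = \<one>" "C \<subseteq> A" "\<one> \<in> C"
    and "\<And>c d. c \<in> C \<Longrightarrow> d \<in> C \<Longrightarrow> c \<otimes> d \<in> C"
    and "\<And>c. c \<in> C \<Longrightarrow> c \<otimes> x \<notin> A"
  obtains V where "A \<subseteq> V" "saturated_subring R V C x y"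
proof -
  obtain V where V: "subring V R" "A \<subseteq> V" "V \<inter> (\<lambda>c. c \<otimes> x) ` C = {}"
    "\<And>W. subring W R \<Longrightarrow> V \<subseteq> W \<Longrightarrow> W \<inter> (\<lambda>c. c \<otimes> x) ` C = {} \<Longrightarrow> W = V"
    using exists_maximal_subring_avoiding[OF assms(1), of "(\<lambda>c. c \<otimes> x) ` C"] assms(8) by blast
  have "saturated_subring R V C x y"
  proof (intro saturated_subring.intro saturated_subring_axioms.intro cring_subring.intro
      cring_subring_axioms.intro)
    show "cring R" by (rule is_cring)
    show "y \<in> V" "C \<subseteq> V" using V(2) assms(2,5) by auto
    show "c \<otimes> x \<notin> V" if "c \<in> C" for c using V(3) that by blast
    show "W = V" if "subring W R" "V \<subseteq> W" "\<And>c. c \<in> C \<Longrightarrow> c \<otimes> x \<notin> W" for W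
      by (rule V(4)[OF that(1,2)]) (use that(3) in blast)
  qed (fact V(1) assms(3,4,6,7))+
  then show thesis using that V(2) by blast
qed

section \<open>Transcendental units\<close>

text \<open>Transcendence of x over K. Raw coefficient lists, leading entry first and possibly zero,
  can be padded and shortened without a normal form.\<close>

definition (in ring) free_over :: "'a set \<Rightarrow> 'a \<Rightarrow> bool" where
  "free_over K x \<longleftrightarrow> (\<forall>p. set p \<subseteq> K \<longrightarrow> eval p x = \<zero> \<longrightarrow> set p \<subseteq> {\<zero>})"

lemma (in ring) free_overD: "free_over K x \<Longrightarrow> set p \<subseteq> K \<Longrightarrow> eval p x = \<zero> \<Longrightarrow> set p \<subseteq> {\<zero>}"
  unfolding free_over_def by blast

lemma (in ring) not_free_overE:
  assumes "\<not> free_over K x" and "K \<subseteq> carrier R" and "x \<in> carrier R"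
  obtains a p where "a \<in> K" "a \<noteq> \<zero>" "set p \<subseteq> K" "eval (a # p) x = \<zero>"
proof -
  obtain q where q: "set q \<subseteq> K" "eval q x = \<zero>" "\<not> set q \<subseteq> {\<zero>}"
    using assms(1) unfolding free_over_def by blast
  then have "\<exists>a p. a \<in> K \<and> a \<noteq> \<zero> \<and> set p \<subseteq> K \<and> eval (a # p) x = \<zero>"
  proof (induct q)
    case (Cons b q)
    show ?case
    proof (cases "b = \<zero>")
      case True
      have "eval q x \<in> carrier R" using Cons(2) assms by (intro eval_in_carrier) auto
      then show ?thesis using Cons True assms(3) by simp
    next
      case False
      then show ?thesis using Cons by (metis list.set_intros(1) set_subset_Cons subset_iff)
    qed
  qed simp
  then show thesis using that by blast
qed

section \<open>Polynomials in two elements, and in a unit and its inverse\<close>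

lemma (in cring) eval_map_comb:
  assumes "z \<in> carrier R" "t \<in> carrier R"
    and "\<And>j. j \<in> set js \<Longrightarrow> f j \<in> carrier R" "\<And>j. j \<in> set js \<Longrightarrow> g j \<in> carrier R"
  shows "eval (map (\<lambda>j. f j \<otimes> z \<oplus> g j) js) t = z \<otimes> eval (map f js) t \<oplus> eval (map g js) t"
  using assms(3,4)
proof (induct js)
  case (Cons j js)
  have c: "f j \<in> carrier R" "g j \<in> carrier R" "eval (map f js) t \<in> carrier R"
    "eval (map g js) t \<in> carrier R" "t [^] length js \<in> carrier R"
    using Cons(2,3) assms(2) by (auto intro!: eval_in_carrier)
  have "eval (map (\<lambda>j. f j \<otimes> z \<oplus> g j) (j # js)) t
      = (f j \<otimes> z \<oplus> g j) \<otimes> t [^] length js \<oplus> (z \<otimes> eval (map f js) t \<oplus> eval (map g js) t)"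
    using Cons by simp
  also have "\<dots> = z \<otimes> (f j \<otimes> t [^] length js \<oplus> eval (map f js) t)
      \<oplus> (g j \<otimes> t [^] length js \<oplus> eval (map g js) t)"
    using c assms(1) by algebra
  finally show ?case by simp
qed (use assms in simp)

lemma (in cring) eval_map_zero: "t \<in> carrier R \<Longrightarrow> eval (map (\<lambda>j. \<zero>) js) t = \<zero>"
  by (induct js) auto

lemma (in cring) eval_map_mult:
  assumes "z \<in> carrier R" "t \<in> carrier R" "set p \<subseteq> carrier R"
  shows "eval (map ((\<otimes>) z) p) t = z \<otimes> eval p t"
proof -
  have "map ((\<otimes>) z) p = map (\<lambda>j. j \<otimes> z \<oplus> \<zero>) p" using assms by (auto simp: m_comm)
  moreover have "eval (map (\<lambda>j. j \<otimes> z \<oplus> \<zero>) p) t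
      = z \<otimes> eval (map (\<lambda>j. j) p) t \<oplus> eval (map (\<lambda>j. \<zero>) p) t"
    by (rule eval_map_comb) (use assms in auto)
  moreover have "\<dots> = z \<otimes> eval p t"
    using assms eval_in_carrier[of p t] by (simp add: eval_map_zero)
  ultimately show ?thesis by metis
qed

text \<open>The order of summation is exchanged in a polynomial in x whose coefficients are
  polynomials in t. A relation for x over K[t] thus becomes one for t over K[x].\<close>

lemma (in cring) eval_transpose:
  assumes "x \<in> carrier R" "t \<in> carrier R"
    and "\<And>P. P \<in> set Ps \<Longrightarrow> length P = J \<and> set P \<subseteq> carrier R"
  shows "eval (map (\<lambda>P. eval P t) Ps) x = eval (map (\<lambda>j. eval (map (\<lambda>P. P ! j) Ps) x) [0..<J]) t"
  using assms(3)
proof (induct Ps)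
  case Nil
  then show ?case using assms(2) by (simp add: eval_map_zero)
next
  case (Cons P Ps)
  have P: "length P = J" "set P \<subseteq> carrier R" using Cons(2) by auto
  have "eval (map (\<lambda>j. P ! j \<otimes> x [^] length Ps \<oplus> eval (map (\<lambda>P. P ! j) Ps) x) [0..<J]) t
    = x [^] length Ps \<otimes> eval (map ((!) P) [0..<J]) t
      \<oplus> eval (map (\<lambda>j. eval (map (\<lambda>P. P ! j) Ps) x) [0..<J]) t"
  proof (rule eval_map_comb)
    fix j assume j: "j \<in> set [0..<J]"
    then show "P ! j \<in> carrier R" using P by (metis atLeastLessThan_iff nth_mem set_upt subsetD)
    show "eval (map (\<lambda>P. P ! j) Ps) x \<in> carrier R"
    proof (rule eval_in_carrier)
      show "set (map (\<lambda>P. P ! j) Ps) \<subseteq> carrier R"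
      proof
        fix a assume "a \<in> set (map (\<lambda>P. P ! j) Ps)"
        then obtain Q where "Q \<in> set Ps" "a = Q ! j" by auto
        then show "a \<in> carrier R" using j Cons(2)[of Q] nth_mem[of j Q] by auto
      qed
    qed fact
  qed (use assms in auto)
  moreover have "map ((!) P) [0..<J] = P" using P by (metis map_nth)
  moreover have "eval P t \<in> carrier R" using P assms by (intro eval_in_carrier)
  ultimately show ?case using Cons assms by (simp add: m_comm)
qed

lemma (in ring) simple_extensionE:
  assumes "subring K R" "t \<in> carrier R" "a \<in> simple_extension K t"
  obtains p where "set p \<subseteq> K" "eval p t = a"
proof -
  have "\<exists>p. set p \<subseteq> K \<and> eval p t = a" using assms(3)
  proof induct
    case (lin k1 k2)
    then obtain p where p: "set p \<subseteq> K" "eval p t = k1" by blast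
    have "eval (p @ [k2]) t = k1 \<otimes> t \<oplus> k2"
      using p lin subringE(1)[OF assms(1)] assms(2) by (subst eval_append_aux) auto
    then show ?case using p lin by (intro exI[of _ "p @ [k2]"]) auto
  qed (auto intro: exI[of _ "[]"])
  then show thesis using that by blast
qed

text \<open>Leading zeros bring all coefficient lists to one length, as the exchange of rows and
  columns requires.\<close>

lemma (in ring) simple_extension_pad:
  assumes "subring K R" "t \<in> carrier R" "set L \<subseteq> simple_extension K t"
  obtains Ps J where "map (\<lambda>P. eval P t) Ps = L" "\<And>P. P \<in> set Ps \<Longrightarrow> length P = J \<and> set P \<subseteq> K"
proof -
  have "\<exists>Ps J. map (\<lambda>P. eval P t) Ps = L \<and> (\<forall>P\<in>set Ps. length P = J \<and> set P \<subseteq> K)"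
    using assms(3)
  proof (induct L)
    case (Cons a L)
    then obtain Ps J where Ps: "map (\<lambda>P. eval P t) Ps = L" "\<And>P. P \<in> set Ps \<Longrightarrow> length P = J \<and> set P \<subseteq> K"
      by auto
    have "a \<in> simple_extension K t" using Cons(2) by simp
    then obtain p where p: "set p \<subseteq> K" "eval p t = a"
      using simple_extensionE[OF assms(1,2)] by blast
    define pad where "pad k P = replicate k \<zero> @ P" for k and P :: "'a list"
    have pad: "eval (pad k P) t = eval P t" "set (pad k P) \<subseteq> K" if "set P \<subseteq> K" for k P
      using that subringE(1,2)[OF assms(1)] assms(2) unfolding pad_def
      by (auto intro!: eval_replicate)
    let ?Ps = "pad (J - length p) p # map (pad (length p - J)) Ps"
    have "map (\<lambda>P. eval P t) ?Ps = a # L" using Ps p pad by auto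
    moreover have "length P = max J (length p) \<and> set P \<subseteq> K" if P: "P \<in> set ?Ps" for P
      using P
    proof (elim set_ConsD[elim_format] disjE)
      assume "P = pad (J - length p) p"
      then show ?thesis using pad(2)[OF p(1)] by (simp add: pad_def)
    next
      assume "P \<in> set (map (pad (length p - J)) Ps)"
      then obtain Q where "Q \<in> set Ps" "P = pad (length p - J) Q" by auto
      then show ?thesis using pad(2)[of Q] Ps(2)[of Q] by (simp add: pad_def)
    qed
    ultimately show ?case by (intro exI[of _ ?Ps] exI[of _ "max J (length p)"]) blast
  qed simp
  then show thesis using that by blast
qed

text \<open>A list of length n has degree below n in x, so after multiplication by y^n every term
  keeps a factor y.\<close>

lemma (in cring) power_eval_inverse:
  assumes "subring K R" "x \<in> carrier R" "y \<in> carrier R" "x \<otimes> y = \<one>" "set p \<subseteq> K"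
  shows "\<exists>b\<in>simple_extension K y. y [^] length p \<otimes> eval p x = y \<otimes> b"
  using assms(5)
proof (induct p)
  case (Cons r p)
  then obtain b where b: "b \<in> simple_extension K y" "y [^] length p \<otimes> eval p x = y \<otimes> b" by auto
  have c: "r \<in> carrier R" "eval p x \<in> carrier R" "b \<in> carrier R"
    using Cons(2) subringE(1)[OF assms(1)] assms(2,3) b(1) simple_extension_in_carrier
    by (auto intro!: eval_in_carrier)
    have xy: "x [^] length p \<otimes> y [^] length p = \<one>"
      using nat_pow_distrib[OF assms(2,3), of "length p"] assms(4) by simp
  have "y [^] length (r # p) \<otimes> eval (r # p) x
      = y \<otimes> (r \<otimes> (x [^] length p \<otimes> y [^] length p) \<oplus> y [^] length p \<otimes> eval p x)"
    using c assms(2,3) by (simp add: r_distr m_ac)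
  also have "\<dots> = y \<otimes> (b \<otimes> y \<oplus> r)"
    using b(2) c assms(3) xy by (simp add: a_comm m_comm)
  finally have "y [^] length (r # p) \<otimes> eval (r # p) x = y \<otimes> (b \<otimes> y \<oplus> r)" .
  moreover have "b \<otimes> y \<oplus> r \<in> simple_extension K y"
    using b(1) Cons(2) by (intro simple_extension.lin) auto
  ultimately show ?case by blast
qed (use assms(3) in \<open>auto intro!: bexI[of _ \<zero>]\<close>)

text \<open>Rewritten in y, a polynomial in x begins with its leading coefficient c. What remains
  beside y^m is therefore an element of \<open>E\<close> when C consists of the nonzero elements of
  K.\<close>

lemma (in cring) power_eval_inverse_nonzero:
  assumes "subring K R" "x \<in> carrier R" "y \<in> carrier R" "x \<otimes> y = \<one>" "set p \<subseteq> K" "eval p x \<noteq> \<zero>"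
  shows "\<exists>(m::nat) c b. c \<in> K - {\<zero>} \<and> b \<in> simple_extension K y
    \<and> y [^] length p \<otimes> eval p x = y [^] m \<otimes> (c \<oplus> y \<otimes> b)"
  using assms(5,6)
proof (induct p)
  case (Cons r p)
  have KC: "K \<subseteq> carrier R" using subringE(1)[OF assms(1)] .
  have c: "r \<in> carrier R" "eval p x \<in> carrier R"
    using Cons(2) KC assms(2,3) by (auto intro!: eval_in_carrier)
  show ?case
  proof (cases "r = \<zero>")
    case True
    then have ev: "eval (r # p) x = eval p x" using c assms(2) by simp
    then obtain m :: nat and d b where *: "d \<in> K - {\<zero>}" "b \<in> simple_extension K y"
      "y [^] length p \<otimes> eval p x = y [^] m \<otimes> (d \<oplus> y \<otimes> b)"
      using Cons by auto
    have dc: "d \<in> carrier R" "b \<in> carrier R"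
      using *(1,2) KC simple_extension_in_carrier[OF KC assms(3)] by auto
    have "y [^] length (r # p) \<otimes> eval p x = y \<otimes> (y [^] length p \<otimes> eval p x)"
      using c assms(3) by (simp add: m_ac)
    also have "\<dots> = y [^] Suc m \<otimes> (d \<oplus> y \<otimes> b)"
      using *(3) dc assms(3) by (simp add: m_ac)
    finally show ?thesis unfolding ev using *(1,2) by blast
  next
    case False
    obtain b where b: "b \<in> simple_extension K y" "y [^] length p \<otimes> eval p x = y \<otimes> b"
      using power_eval_inverse[OF assms(1-4)] Cons(2) by auto
    have bc: "b \<in> carrier R" using b(1) simple_extension_in_carrier[OF KC assms(3)] by auto
        have xy: "x [^] length p \<otimes> y [^] length p = \<one>"
      using nat_pow_distrib[OF assms(2,3), of "length p"] assms(4) by simp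
    have "y [^] length (r # p) \<otimes> eval (r # p) x
        = y \<otimes> (r \<otimes> (x [^] length p \<otimes> y [^] length p) \<oplus> y [^] length p \<otimes> eval p x)"
      using c assms(2,3) by (simp add: r_distr m_ac)
    also have "\<dots> = y [^] (1::nat) \<otimes> (r \<oplus> y \<otimes> b)"
      using b(2) c bc assms(3) xy by simp
    finally show ?thesis using False Cons(2) b(1) by (intro exI[of _ "1::nat"] exI[of _ r] exI[of _ b]) simp
  qed
qed simp

lemma (in cring) simple_extension_power_eval:
  assumes "subring K R" "x \<in> carrier R" "y \<in> carrier R" "x \<otimes> y = \<one>" "a \<in> simple_extension K y"
  shows "\<exists>n p. set p \<subseteq> K \<and> length p = Suc n \<and> x [^] n \<otimes> a = eval p x"
  using assms(5)
proof induct
  case zero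
  show ?case using assms(2) subringE(2)[OF assms(1)]
    by (intro exI[of _ "0::nat"] exI[of _ "[\<zero>]"]) simp
next
  case (lin k1 k2)
  then obtain n p where p: "set p \<subseteq> K" "length p = Suc n" "x [^] n \<otimes> k1 = eval p x" by blast
  have KC: "K \<subseteq> carrier R" using subringE(1)[OF assms(1)] .
  have c: "k1 \<in> carrier R" "k2 \<in> carrier R"
    using lin KC simple_extension_in_carrier assms(3) by blast+
  have "x [^] Suc n \<otimes> (k1 \<otimes> y \<oplus> k2) = k2 \<otimes> x [^] Suc n \<oplus> (x [^] n \<otimes> k1) \<otimes> (x \<otimes> y)"
    using c assms(2,3) by (simp add: r_distr m_ac a_comm)
  also have "\<dots> = eval (k2 # p) x" using p assms(2,4) c p(1) KC eval_in_carrier[of p x] by simp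
  finally show ?case using p lin by (intro exI[of _ "Suc n"] exI[of _ "k2 # p"]) simp
qed

text \<open>A subring K maximal for x being transcendental over it makes R algebraic over K[x].\<close>

lemma (in domain) maximal_subring_if_free_unit:
  assumes x: "x \<in> carrier R" and y: "y \<in> carrier R" and xy: "x \<otimes> y = \<one>"
    and K0: "subring K0 R" "free_over K0 x"
  shows "\<exists>S. maximal_subring S R"
proof -
  obtain K where K: "subring K R" "K0 \<subseteq> K" "free_over K x"
    "\<And>W. subring W R \<Longrightarrow> K \<subseteq> W \<Longrightarrow> free_over W x \<Longrightarrow> W = K"
  proof (rule exists_maximal_subring_with[OF K0(1), of "\<lambda>S. free_over S x"])
    show "free_over (\<Union>\<C>) x"
      if ch: "subset.chain {S. subring S R \<and> free_over S x} \<C>" "\<C> \<noteq> {}" for \<C>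
      unfolding free_over_def
    proof (intro allI impI)
      fix p assume p: "set p \<subseteq> \<Union>\<C>" "eval p x = \<zero>"
      obtain B where B: "B \<in> \<C>" "set p \<subseteq> B"
        using finite_subset_Union_chain[OF _ p(1) ch(2,1)] by auto
      have "free_over B x" using B(1) ch(1) unfolding subset_chain_def by blast
      then show "set p \<subseteq> {\<zero>}" using B(2) p(2) by (rule free_overD)
    qed
  qed (use K0 in auto)
  have KC: "K \<subseteq> carrier R" using subringE(1)[OF K(1)] .
  define A where "A = simple_extension K y"
  have A: "subring A R" "K \<subseteq> A" "y \<in> A"
    unfolding A_def using simple_extension_is_subring[OF K(1) y] simple_extension_incl[OF KC y]
      simple_extension_mem[OF K(1) y] by auto
  obtain V where V: "A \<subseteq> V" "saturated_subring R V (K - {\<zero>}) x y"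
  proof (rule exists_saturated_subring[OF A(1,3) x xy, of "K - {\<zero>}"])
    \<comment> \<open>Multiplied by a power of x, membership in K[y] becomes a polynomial relation
      for x over K with leading coefficient -c.\<close>
    show "c \<otimes> x \<notin> A" if c: "c \<in> K - {\<zero>}" for c
    proof
      assume "c \<otimes> x \<in> A"
      then obtain n p where p: "set p \<subseteq> K" "length p = Suc n" "x [^] n \<otimes> (c \<otimes> x) = eval p x"
        using simple_extension_power_eval[OF K(1) x y xy] unfolding A_def by blast
      have cc: "c \<in> carrier R" using c KC by auto
      have "eval ((\<ominus> c) # p) x = \<ominus> (c \<otimes> x [^] Suc n) \<oplus> x [^] n \<otimes> (c \<otimes> x)"
        using p cc x by (simp add: l_minus)
      also have "\<dots> = \<zero>" using cc x by (simp add: m_ac l_neg)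
      finally have "set ((\<ominus> c) # p) \<subseteq> {\<zero>}"
        using p(1) subringE(5)[OF K(1)] c by (intro free_overD[OF K(3)]) auto
      then show False using c cc by simp
    qed
    show "c \<otimes> d \<in> K - {\<zero>}" if "c \<in> K - {\<zero>}" "d \<in> K - {\<zero>}" for c d
      using that subringE(6)[OF K(1)] subsetD[OF KC] integral_iff[of c d] by auto
  qed (use A subringE(3)[OF K(1)] in auto)
  interpret saturated_subring R V "K - {\<zero>}" x y by (rule V(2))
  show ?thesis
  proof (rule maximal_subring_if_absorbing)
    fix t assume t: "t \<in> carrier R"
    show "\<exists>n::nat. y [^] n \<otimes> t \<in> V"
    proof (cases "t \<in> K")
      case True
      then have "t \<in> V" using A(2) V(1) by blast
      then show ?thesis by (intro exI[of _ "0::nat"]) simp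
    next
      case False
      let ?W = "simple_extension K t"
      have W: "subring ?W R" "K \<subseteq> ?W" "t \<in> ?W"
        using simple_extension_is_subring[OF K(1) t] simple_extension_incl[OF KC t]
          simple_extension_mem[OF K(1) t] by auto
      \<comment> \<open>K[t] is strictly larger than K, so the maximal choice of K makes x algebraic
        over it.\<close>
      then have "\<not> free_over ?W x" using K(4) False by metis
      then obtain L where L: "set L \<subseteq> ?W" "eval L x = \<zero>" "\<not> set L \<subseteq> {\<zero>}"
        unfolding free_over_def by blast
      obtain Ps J where Ps: "map (\<lambda>P. eval P t) Ps = L" "\<And>P. P \<in> set Ps \<Longrightarrow> length P = J \<and> set P \<subseteq> K"
        using simple_extension_pad[OF K(1) t L(1)] by blast
      define row where "row j = map (\<lambda>P. P ! j) Ps" for j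
      have row: "set (row j) \<subseteq> K" "length (row j) = length Ps" if "j < J" for j
      proof -
        show "set (row j) \<subseteq> K"
        proof
          fix a assume "a \<in> set (row j)"
          then obtain Q where "Q \<in> set Ps" "a = Q ! j" unfolding row_def by auto
          then show "a \<in> K" using that Ps(2)[of Q] nth_mem[of j Q] by auto
        qed
      qed (simp add: row_def)
      have rows: "eval (map (\<lambda>j. eval (row j) x) [0..<J]) t = \<zero>"
      proof -
        have "length P = J \<and> set P \<subseteq> carrier R" if "P \<in> set Ps" for P
          using Ps(2)[OF that] KC by (blast intro: subset_trans)
        then have "eval (map (\<lambda>P. eval P t) Ps) x = eval (map (\<lambda>j. eval (row j) x) [0..<J]) t"
          unfolding row_def by (rule eval_transpose[OF x t])
        then show ?thesis unfolding Ps(1) L(2) by simp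
      qed
      have "\<exists>j<J. eval (row j) x \<noteq> \<zero>"
      proof (rule ccontr)
        assume "\<not> ?thesis"
        then have z: "set (row j) \<subseteq> {\<zero>}" if "j < J" for j
          using free_overD[OF K(3)] row that by blast
        have "set P \<subseteq> {\<zero>}" if P: "P \<in> set Ps" for P
        proof
          fix a assume "a \<in> set P"
          then obtain j where "j < J" "a = P ! j" using Ps(2)[OF P] by (metis in_set_conv_nth)
          then show "a \<in> {\<zero>}" using z[of j] P unfolding row_def by auto
        qed
        have "eval P t = \<zero>" if "P \<in> set Ps" for P
        proof -
          have "map (\<lambda>_. \<zero>) P = P" using \<open>\<And>P. P \<in> set Ps \<Longrightarrow> set P \<subseteq> {\<zero>}\<close>[OF that]
            by (intro map_idI) auto
          then show ?thesis using eval_map_zero[OF t, of P] by simp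
        qed
        then have "set L \<subseteq> {\<zero>}" unfolding Ps(1)[symmetric] by auto
        then show False using L(3) by blast
      qed
      \<comment> \<open>Rows are ordered by falling powers of t, so the least index belongs to the
        true leading coefficient.\<close>
      then obtain j where j: "j < J" "eval (row j) x \<noteq> \<zero>" "\<And>i. i < j \<Longrightarrow> eval (row i) x = \<zero>"
        using exists_least_iff[of "\<lambda>j. j < J \<and> eval (row j) x \<noteq> \<zero>"] by (metis order.strict_trans)
      \<comment> \<open>Every row has \<open>length Ps\<close> entries, so this one power of y moves
        all coefficients from K[x] into \<open>A\<close>.\<close>
      define z where "z = y [^] length Ps"
      define f where "f i = z \<otimes> eval (row i) x" for i
      have zc: "z \<in> carrier R" unfolding z_def using y by simp
      have evc: "eval (row i) x \<in> carrier R" if "i < J" for i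
        using row[OF that] KC x by (intro eval_in_carrier) auto
      have split: "[0..<J] = [0..<j] @ j # [Suc j..<J]"
        using j(1) by (metis le_add1 less_imp_le upt_add_eq_append upt_conv_Cons le_add_diff_inverse add_0)
      have fz: "map f [0..<j] = map (\<lambda>i. \<zero>) [0..<j]"
        using j(3) zc unfolding f_def by simp
      have "eval (map f [0..<J]) t = z \<otimes> eval (map (\<lambda>j. eval (row j) x) [0..<J]) t"
      proof -
        have "set (map (\<lambda>j. eval (row j) x) [0..<J]) \<subseteq> carrier R" using evc by auto
        from eval_map_mult[OF zc t this] show ?thesis unfolding f_def by (simp add: comp_def)
      qed
      then have "eval (map f [0..<J]) t = \<zero>" using rows zc by simp
      moreover have fc: "set (map f (j # [Suc j..<J])) \<subseteq> carrier R"
        using evc zc j(1) unfolding f_def by auto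
      moreover have "map f [0..<J] = replicate j \<zero> @ map f (j # [Suc j..<J])"
        unfolding split map_append fz by (simp add: map_replicate_const)
      ultimately have root: "eval (f j # map f [Suc j..<J]) t = \<zero>"
        using eval_replicate[OF fc t, of j] by simp
      have fA: "f i \<in> A" if "i < J" for i
        using power_eval_inverse[OF K(1) x y xy row(1)[OF that]] row(2)[OF that] A subringE(6)[OF A(1)]
        unfolding f_def z_def A_def by auto
      obtain m :: nat and c b where mcb: "c \<in> K - {\<zero>}" "b \<in> A" "f j = y [^] m \<otimes> (c \<oplus> y \<otimes> b)"
        using power_eval_inverse_nonzero[OF K(1) x y xy row(1)[OF j(1)] j(2)] row(2)[OF j(1)]
        unfolding f_def z_def A_def by auto
      have "map f [Suc j..<J] \<noteq> []"
      proof
        assume e: "map f [Suc j..<J] = []"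
        have "f j = \<zero>" using root fc unfolding e by simp
        moreover have "x [^] length Ps \<otimes> f j = eval (row j) x"
        proof -
          have "x [^] length Ps \<otimes> f j = (x \<otimes> y) [^] length Ps \<otimes> eval (row j) x"
            unfolding f_def z_def using x y evc[OF j(1)] by (simp add: nat_pow_distrib m_assoc)
          then show ?thesis using xy evc[OF j(1)] by simp
        qed
        ultimately show False using j(2) x by simp
      qed
      moreover have "set (map f [Suc j..<J]) \<subseteq> V" using fA V(1) by auto
      moreover have "c \<oplus> y \<otimes> b \<in> E" using EI mcb V(1) by blast
      ultimately have "y [^] m \<otimes> t \<in> V"
        using power_mult_in[OF t] root unfolding mcb(3) by blast
      then show ?thesis by blast
    qed
  qed
qed

text \<open>Over a countable K there are only countably many polynomials, and in a domain a nonzero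
  one has finitely many roots; these cannot exhaust R.\<close>

lemma (in domain) exists_free_if_uncountable:
  assumes K: "subring K R" "countable K" and "uncountable (carrier R)"
  shows "\<exists>x \<in> carrier R. free_over K x"
proof (rule ccontr)
  assume "\<not> (\<exists>x \<in> carrier R. free_over K x)"
  then have nf: "\<not> free_over K x" if "x \<in> carrier R" for x using that by blast
  have KC: "K \<subseteq> carrier R" using subringE(1)[OF K(1)] .
  let ?P = "{p \<in> lists K. p \<in> carrier (poly_ring R)}"
  have "carrier R \<subseteq> (\<Union>p\<in>?P. {x. is_root p x})"
  proof
    fix x assume x: "x \<in> carrier R"
    obtain a p where "a \<in> K" "a \<noteq> \<zero>" "set p \<subseteq> K" "eval (a # p) x = \<zero>"
      using not_free_overE[OF nf[OF x] KC x] by blast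
    then have "a # p \<in> ?P" "is_root (a # p) x"
      using x KC unfolding is_root_def univ_poly_carrier[symmetric] polynomial_def by auto
    then show "x \<in> (\<Union>p\<in>?P. {x. is_root p x})" by blast
  qed
  moreover have "countable (\<Union>p\<in>?P. {x. is_root p x})"
  proof (rule countable_UN)
    show "countable ?P" by (rule countable_subset[OF _ countable_lists[OF K(2)]]) blast
    show "countable {x. is_root p x}" if "p \<in> ?P" for p
      using that finite_number_of_roots by (auto intro: countable_finite)
  qed
  ultimately show False using assms(3) countable_subset by blast
qed

section \<open>The prime subring and uncountable fields\<close>

abbreviation (in ring) zmult :: "int \<Rightarrow> 'a" where
  "zmult k \<equiv> add_pow R k \<one>"

lemma (in ring) zmult_0 [simp]: "zmult 0 = \<zero>"
  by (simp add: add_pow_def)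

definition (in ring) integer_multiples :: "'a set" where
  "integer_multiples = range zmult"

lemma (in ring) int_mult_one_mult: "(zmult i) \<otimes> (zmult j) = zmult (i * j)"
proof -
  have "(zmult i) \<otimes> (zmult j) = add_pow R i (zmult j)"
    by (simp add: add_pow_ldistr_int)
  then show ?thesis by (simp add: add.int_pow_pow mult.commute)
qed

lemma (in ring) subring_integer_multiples: "subring integer_multiples R"
proof (rule subringI)
  show "integer_multiples \<subseteq> carrier R" unfolding integer_multiples_def by auto
  show "\<one> \<in> integer_multiples" unfolding integer_multiples_def
    by (rule range_eqI[of _ _ 1]) simp
  fix h assume "h \<in> integer_multiples"
  then obtain i :: int where i: "h = zmult i" unfolding integer_multiples_def by blast
  have "\<ominus> h = zmult (- i)" unfolding i by (simp add: add.int_pow_neg)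
  then show "\<ominus> h \<in> integer_multiples" unfolding integer_multiples_def by blast
  fix k assume "k \<in> integer_multiples"
  then obtain j :: int where j: "k = zmult j" unfolding integer_multiples_def by blast
  show "h \<otimes> k \<in> integer_multiples"
    unfolding i j int_mult_one_mult integer_multiples_def by blast
  have "h \<oplus> k = zmult (i + j)" unfolding i j by (simp add: add.int_pow_mult)
  then show "h \<oplus> k \<in> integer_multiples" unfolding integer_multiples_def by blast
qed

lemma (in field) maximal_subring_if_uncountable:
  assumes "uncountable (carrier R)"
  shows "\<exists>S. maximal_subring S R"
proof -
  have "countable integer_multiples" unfolding integer_multiples_def by simp
  then obtain x where x: "x \<in> carrier R" "free_over integer_multiples x"
    using exists_free_if_uncountable[OF subring_integer_multiples _ assms] by blast
  have "x \<noteq> \<zero>"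
  proof
    assume "x = \<zero>"
    then have "eval [\<one>, \<zero>] x = \<zero>" by simp
    moreover have "set [\<one>, \<zero>] \<subseteq> integer_multiples"
      using subringE(2,3)[OF subring_integer_multiples] by simp
    ultimately show False using free_overD[OF x(2)] by fastforce
  qed
  then obtain y where "y \<in> carrier R" "x \<otimes> y = \<one>"
    using x(1) field_Units by (metis Diff_iff Units_r_inv_ex empty_iff insert_iff)
  then show ?thesis
    using maximal_subring_if_free_unit[OF x(1) _ _ subring_integer_multiples x(2)] by blast
qed

section \<open>Residue fields and the Jacobson property\<close>

text \<open>The preimage of V contains the kernel, so every subring above it is determined by its
  image. This is what passes the absence of maximal subrings on to quotients.\<close>

lemma (in ring_hom_ring) maximal_subring_vimage:
  assumes surj: "h ` carrier R = carrier S" and V: "maximal_subring V S"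
  shows "maximal_subring {a \<in> carrier R. h a \<in> V} R"
proof -
  let ?U = "{a \<in> carrier R. h a \<in> V}"
  have VS: "subring V S" "V \<noteq> carrier S" using V unfolding maximal_subring_def by auto
  note VE = subringE[OF VS(1)]
  have pre: "\<exists>a\<in>carrier R. h a = v" if "v \<in> carrier S" for v
    using that surj by (metis imageE)
  have "subring ?U R"
  proof (rule R.subringI)
    show "?U \<subseteq> carrier R" by blast
    show "\<one>\<^bsub>R\<^esub> \<in> ?U" using VE(3) by simp
    show "\<ominus>\<^bsub>R\<^esub> a \<in> ?U" if "a \<in> ?U" for a using that VE(5) by simp
    show "a \<otimes>\<^bsub>R\<^esub> b \<in> ?U" if "a \<in> ?U" "b \<in> ?U" for a b using that VE(6) by simp
    show "a \<oplus>\<^bsub>R\<^esub> b \<in> ?U" if "a \<in> ?U" "b \<in> ?U" for a b using that VE(7) by simp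
  qed
  moreover have "?U \<noteq> carrier R"
  proof
    assume eq: "?U = carrier R"
    have "v \<in> V" if v: "v \<in> carrier S" for v
    proof -
      obtain a where "a \<in> carrier R" "h a = v" using pre[OF v] by blast
      then show ?thesis using eq by auto
    qed
    then show False using VS(2) VE(1) by blast
  qed
  moreover have "W = ?U" if W: "subring W R" "?U \<subseteq> W" "W \<noteq> carrier R" for W
  proof -
    note WE = subringE[OF W(1)]
    have hW: "subring (h ` W) S" by (rule img_is_subring[OF W(1)])
    have VhW: "V \<subseteq> h ` W"
    proof
      fix v assume "v \<in> V"
      then obtain a where "a \<in> carrier R" "v = h a" using VE(1) surj by blast
      then show "v \<in> h ` W" using \<open>v \<in> V\<close> W(2) by blast
    qed
    have "h ` W \<noteq> carrier S"
    proof
      assume eq: "h ` W = carrier S"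
      have "a \<in> W" if a: "a \<in> carrier R" for a
      proof -
        have "h a \<in> h ` W" unfolding eq using a by simp
        then obtain w where w: "w \<in> W" "h a = h w" by blast
        have wc: "w \<in> carrier R" using w(1) WE(1) by blast
        have "h (a \<ominus> w) = \<zero>\<^bsub>S\<^esub>" using a wc w(2) by (simp add: R.minus_eq S.r_neg)
        then have "a \<ominus> w \<in> ?U" using a wc VE(2) by simp
        then have "a \<ominus> w \<in> W" using W(2) by blast
        then have "(a \<ominus> w) \<oplus> w \<in> W" using w(1) WE(7) by blast
        moreover have "(a \<ominus> w) \<oplus> w = a" using a wc by (simp add: R.minus_eq R.a_assoc R.l_neg)
        ultimately show ?thesis by simp
      qed
      then show False using W(3) WE(1) by blast
    qed
    then have hWV: "h ` W = V" using V hW VhW unfolding maximal_subring_def by blast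
    have "W \<subseteq> ?U" using hWV WE(1) by blast
    then show ?thesis using W(2) by blast
  qed
  ultimately show ?thesis unfolding maximal_subring_def by blast
qed

lemma (in ring) carrier_FactRing: "carrier (R Quot I) = (+>) I ` carrier R"
  by (auto simp: FactRing_def A_RCOSETS_def')

lemma (in ring) maximal_subring_quotientD:
  assumes "ideal I R" and "\<exists>V. maximal_subring V (R Quot I)"
  shows "\<exists>V. maximal_subring V R"
proof -
  interpret h: ring_hom_ring R "R Quot I" "(+>) I" by (rule ideal.rcos_ring_hom_ring[OF assms(1)])
  show ?thesis using h.maximal_subring_vimage[OF carrier_FactRing[symmetric]] assms(2) by blast
qed

text \<open>Serves two purposes: a general x leads to a prime ideal missing x, and x = 1 leads to a
  maximal ideal.\<close>

lemma (in cring) exists_maximal_ideal_avoiding_powers: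
  assumes "ideal I R" "\<And>n::nat. x [^] n \<notin> I"
  shows "\<exists>P. ideal P R \<and> I \<subseteq> P \<and> (\<forall>n::nat. x [^] n \<notin> P)
    \<and> (\<forall>J. ideal J R \<longrightarrow> P \<subset> J \<longrightarrow> (\<exists>n::nat. x [^] n \<in> J))"
proof -
  let ?SS = "{J. ideal J R \<and> I \<subseteq> J \<and> (\<forall>n::nat. x [^] n \<notin> J)}"
  have "\<exists>M \<in> ?SS. \<forall>J \<in> ?SS. M \<subseteq> J \<longrightarrow> J = M"
  proof (rule subset_Zorn_nonempty)
    show "?SS \<noteq> {}" using assms by blast
    fix \<C> assume ne: "\<C> \<noteq> {}" and ch: "subset.chain ?SS \<C>"
    then have "subset.chain {J. ideal J R} \<C>" by (auto simp: subset_chain_def)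
    from chain_Union_is_ideal[OF this] ne have "ideal (\<Union>\<C>) R" by simp
    moreover have "I \<subseteq> \<Union>\<C>" "\<forall>n::nat. x [^] n \<notin> \<Union>\<C>"
      using ch ne unfolding subset_chain_def by blast+
    ultimately show "\<Union>\<C> \<in> ?SS" by blast
  qed
  then obtain P where P: "P \<in> ?SS" and max: "\<forall>J \<in> ?SS. P \<subseteq> J \<longrightarrow> J = P" ..
  have "\<exists>n::nat. x [^] n \<in> J" if J: "ideal J R" "P \<subset> J" for J
  proof (rule ccontr)
    assume "\<not> ?thesis"
    then have "J \<in> ?SS" using P J by blast
    then show False using max J(2) by blast
  qed
  then show ?thesis using P by (intro exI[of _ P]) auto
qed

lemma (in cring) exists_prime_ideal_avoiding_powers:
  assumes "ideal I R" "x \<in> carrier R" "\<And>n::nat. x [^] n \<notin> I"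
  obtains P where "primeideal P R" "I \<subseteq> P" "x \<notin> P"
proof -
  from exists_maximal_ideal_avoiding_powers[OF assms(1,3)]
  obtain P where P: "ideal P R" "I \<subseteq> P" "\<forall>n::nat. x [^] n \<notin> P"
    and max: "\<forall>J. ideal J R \<longrightarrow> P \<subset> J \<longrightarrow> (\<exists>n::nat. x [^] n \<in> J)" by (elim exE conjE)
  interpret P: ideal P R by fact
  \<comment> \<open>The colon ideal of a is strictly above P and so contains a power of x. Used once
    for a and b, and again for that power of x and a, this puts a product of two powers of x into
    P.\<close>
  have colon: "\<exists>n::nat. a \<otimes> x [^] n \<in> P"
    if a: "a \<in> carrier R" and b: "b \<in> carrier R" "a \<otimes> b \<in> P" "b \<notin> P" for a b
  proof -
    let ?J = "{r \<in> carrier R. a \<otimes> r \<in> P}"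
    have "ideal ?J R" by (rule P.helper_max_prime[OF is_cring a])
    moreover have "P \<subset> ?J" using a b P.I_l_closed P.Icarr by blast
    ultimately have "\<exists>n::nat. x [^] n \<in> ?J" using max by (elim allE[of _ ?J]) (elim impE)
    then show ?thesis by blast
  qed
  have "primeideal P R"
  proof (rule primeidealI[OF P(1) is_cring])
    show "carrier R \<noteq> P" using P(3) one_closed nat_pow_0 by metis
    show "a \<in> P \<or> b \<in> P" if ab: "a \<in> carrier R" "b \<in> carrier R" "a \<otimes> b \<in> P" for a b
    proof (rule ccontr)
      assume no: "\<not> (a \<in> P \<or> b \<in> P)"
      then obtain n :: nat where n: "a \<otimes> x [^] n \<in> P" using colon[OF ab] by blast
      then have "x [^] n \<otimes> a \<in> P" using ab assms(2) by (simp add: m_comm)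
      then obtain m :: nat where "x [^] n \<otimes> x [^] m \<in> P"
        using colon[of "x [^] n" a] ab(1) assms(2) no by auto
      then show False using P(3)[rule_format, of "n + m"] assms(2) by (simp add: nat_pow_mult)
    qed
  qed
  then show thesis using that[of P] P(2) P(3)[rule_format, of 1] assms(2) by simp
qed

lemma (in cring) exists_maximal_ideal_above:
  assumes "ideal I R" "\<one> \<notin> I"
  obtains M where "maximalideal M R" "I \<subseteq> M"
proof -
  have "\<one> [^] n \<notin> I" for n :: nat using assms(2) by simp
  from exists_maximal_ideal_avoiding_powers[OF assms(1) this]
  obtain P where P: "ideal P R" "I \<subseteq> P" "\<one> \<notin> P"
    and max: "\<forall>J. ideal J R \<longrightarrow> P \<subset> J \<longrightarrow> \<one> \<in> J"
    by (elim exE conjE) simp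
  have "maximalideal P R"
  proof (rule maximalidealI[OF P(1)])
    show "carrier R \<noteq> P" using P(3) by auto
    show "J = P \<or> J = carrier R" if J: "ideal J R" "P \<subseteq> J" for J
      using max J ideal.one_imp_carrier[OF J(1)] by (cases "J = P") auto
  qed
  then show thesis using that P(2) by blast
qed

lemma (in cring) comaximal_if_no_common_maximal_ideal:
  assumes I: "ideal I R" and J: "ideal J R"
    and no: "\<And>M. maximalideal M R \<Longrightarrow> I \<subseteq> M \<Longrightarrow> \<not> J \<subseteq> M"
  shows "\<exists>i\<in>I. \<exists>j\<in>J. i \<oplus> j = \<one>"
proof -
  interpret I: ideal I R by fact
  interpret J: ideal J R by fact
  define L where "L = set_add R I J"
  have LI: "i \<oplus> j \<in> L" if "i \<in> I" "j \<in> J" for i j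
    unfolding L_def set_add_def' using that by blast
  have "ideal L R" unfolding L_def by (rule add_ideals[OF I J])
  moreover have "I \<subseteq> L" using LI[OF _ J.zero_closed] I.Icarr by force
  moreover have "J \<subseteq> L" using LI[OF I.zero_closed] J.Icarr by force
  ultimately have "\<one> \<in> L" using no exists_maximal_ideal_above by (metis subset_trans)
  then show ?thesis unfolding L_def set_add_def' by (auto intro: sym)
qed

section \<open>Domains with a nonzero element in the Jacobson radical\<close>

text \<open>Horner's scheme for division by u - 1, where u = 1 + x. The remainder c is the value of
  the polynomial at 1, hence in K, and the quotient inherits the leading coefficient.\<close>

lemma (in cring) synthetic_division:
  assumes K: "subring K R" and x: "x \<in> carrier R" and "set (a # p) \<subseteq> K"
  shows "\<exists>q c. set q \<subseteq> K \<and> length q = length p \<and> (p \<noteq> [] \<longrightarrow> hd q = a) \<and> c \<in> K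
    \<and> eval (a # p) (\<one> \<oplus> x) = x \<otimes> eval q (\<one> \<oplus> x) \<oplus> c"
  using assms(3)
proof (induct p arbitrary: a)
  case Nil
  then have "a \<in> carrier R" using subringE(1)[OF K] by auto
  then show ?case using Nil x by (intro exI[of _ "[]"] exI[of _ a]) simp
next
  case (Cons b p)
  have KC: "K \<subseteq> carrier R" using subringE(1)[OF K] .
  let ?u = "\<one> \<oplus> x"
  have "set ((a \<oplus> b) # p) \<subseteq> K" using Cons(2) subringE(7)[OF K] by auto
  from Cons(1)[OF this] obtain q c where q: "set q \<subseteq> K" "length q = length p" "c \<in> K"
    "eval ((a \<oplus> b) # p) ?u = x \<otimes> eval q ?u \<oplus> c" by blast
  define z where "z = ?u [^] length p"
  have c: "a \<in> carrier R" "b \<in> carrier R" "c \<in> carrier R" "eval q ?u \<in> carrier R"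
    "eval p ?u \<in> carrier R" "z \<in> carrier R"
    using Cons(2) q(1,3) KC x unfolding z_def by (auto intro!: eval_in_carrier)
  have "eval (a # b # p) ?u = a \<otimes> (z \<otimes> ?u) \<oplus> (b \<otimes> z \<oplus> eval p ?u)"
    unfolding z_def by simp
  also have "\<dots> = x \<otimes> (a \<otimes> z) \<oplus> ((a \<oplus> b) \<otimes> z \<oplus> eval p ?u)"
    using c x by algebra
  also have "(a \<oplus> b) \<otimes> z \<oplus> eval p ?u = x \<otimes> eval q ?u \<oplus> c"
    using q(4) unfolding z_def by simp
  also have "x \<otimes> (a \<otimes> z) \<oplus> (x \<otimes> eval q ?u \<oplus> c) = x \<otimes> (a \<otimes> z \<oplus> eval q ?u) \<oplus> c"
    using c x by algebra
  also have "a \<otimes> z \<oplus> eval q ?u = eval (a # q) ?u" unfolding z_def using q(2) by simp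
  finally show ?case using q Cons(2) by (intro exI[of _ "a # q"] exI[of _ c]) simp
qed

text \<open>As long as the remainder is zero, x cancels and the degree drops while the leading
  coefficient stays a. As a is nonzero, a nonzero remainder must appear, and it is a multiple of
  x.\<close>

lemma (in domain) multiple_in_subring_if_algebraic:
  assumes K: "subring K R" and x: "x \<in> carrier R" "x \<noteq> \<zero>"
    and "a \<in> K" "a \<noteq> \<zero>" "set p \<subseteq> K" "eval (a # p) (\<one> \<oplus> x) = \<zero>"
  shows "\<exists>n d. n \<in> K \<and> n \<noteq> \<zero> \<and> d \<in> carrier R \<and> n = x \<otimes> d"
  using assms(6,7)
proof (induct "length p" arbitrary: p)
  case 0
  then show ?case using assms(4,5) subringE(1)[OF K] by auto
next
  case (Suc k)
  have KC: "K \<subseteq> carrier R" using subringE(1)[OF K] .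
  let ?u = "\<one> \<oplus> x"
  have "set (a # p) \<subseteq> K" using assms(4) Suc(3) by simp
  from synthetic_division[OF K x(1) this] obtain q c where
    q: "set q \<subseteq> K" "length q = length p" "p \<noteq> [] \<longrightarrow> hd q = a" "c \<in> K"
      "eval (a # p) ?u = x \<otimes> eval q ?u \<oplus> c" by blast
  have ec: "eval q ?u \<in> carrier R" using q(1) KC x by (intro eval_in_carrier) auto
  have cc: "c \<in> carrier R" using q(4) KC by blast
  show ?case
  proof (cases "c = \<zero>")
    case True
    then have "eval q ?u = \<zero>" using q(5) Suc(4) ec x integral_iff by simp
    moreover obtain q' where "q = a # q'" using q(2,3) Suc(2) by (cases q) auto
    ultimately show ?thesis using Suc(1)[of q'] q(1,2) Suc(2) by auto
  next
    case False
    have "c \<oplus> x \<otimes> eval q ?u = \<zero>" using q(5) Suc(4) ec cc x by (simp add: a_comm)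
    then have "c = \<ominus> (x \<otimes> eval q ?u)" using ec cc x by (intro sum_zero_eq_neg) auto
    then have "c = x \<otimes> (\<ominus> eval q ?u)" using ec x by (simp add: r_minus)
    then show ?thesis using False q(4) ec by blast
  qed
qed

text \<open>Let g be the gcd of k and the characteristic. It does not vanish in R, since its
  multiple k does not; so the cofactor vanishes, and minimality of the characteristic gives g = 1.
  Bezout's identity supplies the inverse.\<close>

lemma (in domain) coprime_to_characteristic:
  fixes k :: int and m :: nat
  assumes "zmult k \<noteq> \<zero>" and "m > 0" "zmult (int m) = \<zero>"
  shows "\<exists>b. zmult b \<otimes> zmult k = \<one>"
proof -
  define m0 where "m0 = (LEAST m. m > 0 \<and> zmult (int m) = \<zero>)"
  have m0: "m0 > 0" "zmult (int m0) = \<zero>" and least: "\<And>j. j > 0 \<Longrightarrow> zmult (int j) = \<zero> \<Longrightarrow> m0 \<le> j"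
    using LeastI[of "\<lambda>m. m > 0 \<and> zmult (int m) = \<zero>" m] assms(2,3)
      Least_le[of "\<lambda>m. m > 0 \<and> zmult (int m) = \<zero>"] unfolding m0_def by auto
  define g where "g = gcd (int m0) k"
  obtain m1 k1 where mk: "int m0 = g * m1" "k = g * k1"
    unfolding g_def by (metis dvdE gcd_dvd1 gcd_dvd2)
  have gpos: "g > 0" unfolding g_def using m0(1) by (simp add: gcd_pos_int)
  then have m1pos: "m1 > 0" using m0(1) mk(1) by (metis of_nat_0_less_iff zero_less_mult_pos)
  have "zmult g \<noteq> \<zero>"
  proof
    assume "zmult g = \<zero>"
    then have "zmult g \<otimes> zmult k1 = \<zero>" by simp
    then show False using assms(1) unfolding mk(2) int_mult_one_mult by simp
  qed
  moreover have "zmult g \<otimes> zmult m1 = \<zero>" using m0(2) unfolding mk(1) int_mult_one_mult .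
  ultimately have "zmult m1 = \<zero>" using integral_iff by simp
  then have "m0 \<le> nat m1" using least[of "nat m1"] m1pos by simp
  then have "g * m1 \<le> 1 * m1" using mk(1) m1pos by linarith
  then have "g = 1" using gpos m1pos by (metis mult_le_cancel_right not_le order_antisym int_one_le_iff_zero_less)
  then obtain a b where "a * int m0 + b * k = 1" unfolding g_def by (metis bezout_int)
  then have "zmult (a * int m0 + b * k) = \<one>" by simp
  then have "zmult a \<otimes> zmult (int m0) \<oplus> zmult b \<otimes> zmult k = \<one>"
    unfolding int_mult_one_mult by (simp add: add.int_pow_mult)
  then show ?thesis using m0(2) by auto
qed

text \<open>The q-adic counterpart of the transcendental case: y is q, and C consists of the
  integers not divisible by q. Algebraicity is asked of the elements 1 + k t because these are units
  when k lies in the Jacobson radical; for fields k = 1 serves.\<close>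

lemma (in domain) maximal_subring_if_prime_unit:
  fixes q k :: int
  assumes inj: "\<And>i. zmult i = \<zero> \<Longrightarrow> i = 0"
    and q: "Factorial_Ring.prime q" and xi: "xi \<in> carrier R" "xi \<otimes> zmult q = \<one>"
    and k: "zmult k \<noteq> \<zero>"
    and alg: "\<And>t. t \<in> carrier R \<Longrightarrow> \<not> free_over integer_multiples (\<one> \<oplus> zmult k \<otimes> t)"
  shows "\<exists>S. maximal_subring S R"
proof -
  let ?Z = integer_multiples
  note Z = subring_integer_multiples
  have ZC: "?Z \<subseteq> carrier R" using subringE(1)[OF Z] .
  have injd: "i = j" if "zmult i = zmult j" for i j
    using inj[of "i - j"] that by (simp add: add.int_pow_diff r_neg)
  have q1: "\<not> q dvd 1" using q Factorial_Ring.not_prime_unit[of q] by blast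
  define y where "y = zmult q"
  have y: "y \<in> carrier R" "y \<in> ?Z" unfolding y_def integer_multiples_def by auto
  have xy: "xi \<otimes> y = \<one>" using xi(2) unfolding y_def .
  define C where "C = zmult ` {c. \<not> q dvd c}"
  obtain V where V: "?Z \<subseteq> V" "saturated_subring R V C xi y"
  proof (rule exists_saturated_subring[OF Z y(2) xi(1) xy, of C])
    show "C \<subseteq> ?Z" unfolding C_def integer_multiples_def by blast
    show "\<one> \<in> C" unfolding C_def using q1 by (intro image_eqI[of _ _ 1]) auto
    show "a \<otimes> b \<in> C" if "a \<in> C" "b \<in> C" for a b
      using that q unfolding C_def by (auto simp: int_mult_one_mult Factorial_Ring.prime_dvd_mult_iff)
    show "c \<otimes> xi \<notin> ?Z" if "c \<in> C" for c
    proof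
      assume "c \<otimes> xi \<in> ?Z"
      then obtain j where j: "c \<otimes> xi = zmult j" unfolding integer_multiples_def by blast
      obtain i where i: "c = zmult i" "\<not> q dvd i" using \<open>c \<in> C\<close> unfolding C_def by blast
      have "c = c \<otimes> (xi \<otimes> y)" using i xy by simp
      also have "\<dots> = zmult j \<otimes> y" using j i xi(1) y by (simp add: m_assoc[symmetric])
      finally have "zmult i = zmult (j * q)" unfolding i y_def int_mult_one_mult .
      then show False using injd[of i "j * q"] i(2) by simp
    qed
  qed blast
  interpret saturated_subring R V C xi y by (rule V(2))
  have decomp: "\<exists>m c. c \<in> C \<and> zmult l = y [^] (m::nat) \<otimes> c" if "zmult l \<noteq> \<zero>" for l
  proof -
    have "l \<noteq> 0" using that zmult_0 by metis
    then obtain c where c: "l = q ^ multiplicity q l * c" "\<not> q dvd c"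
      using multiplicity_decompose'[of l q] q1 by blast
    have "zmult (q ^ m) = y [^] m" for m :: nat
      unfolding y_def by (induct m) (auto simp: m_comm simp flip: int_mult_one_mult)
    then have "zmult l = y [^] multiplicity q l \<otimes> zmult c"
      by (subst c(1)) (simp flip: int_mult_one_mult)
    then show ?thesis using c(2) unfolding C_def by blast
  qed
  obtain m' c' where c': "c' \<in> C" "zmult k = y [^] (m'::nat) \<otimes> c'" using decomp k by blast
  show ?thesis
  proof (rule maximal_subring_if_absorbing)
    fix t assume t: "t \<in> carrier R"
    define w where "w = \<one> \<oplus> zmult k \<otimes> t"
    have wc: "w \<in> carrier R" unfolding w_def using t by simp
    from not_free_overE[OF alg[OF t] ZC, folded w_def, OF wc] obtain a p where
      ap: "a \<in> ?Z" "a \<noteq> \<zero>" "set p \<subseteq> ?Z" "eval (a # p) w = \<zero>" by blast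
    then obtain m c where c: "c \<in> C" "a = y [^] (m::nat) \<otimes> c"
      using decomp unfolding integer_multiples_def by blast
    have "p \<noteq> []" using ap subsetD[OF ZC] by auto
    then have yw: "y [^] m \<otimes> w \<in> V"
      using power_mult_in[OF wc, of p c m] ap(3,4) V(1) C_sub_E[OF c(1)] unfolding c(2) by blast
    \<comment> \<open>The way back from w to t: subtracting y^m removes the summand 1, then the part
      of k prime to q cancels and only powers of y are left.\<close>
    have "zmult k \<otimes> t = w \<ominus> \<one>" unfolding w_def using t add.int_pow_closed[OF one_closed] by algebra
    then have "y [^] m \<otimes> (zmult k \<otimes> t) = y [^] m \<otimes> w \<ominus> y [^] m"
      using wc y(1) by (simp add: minus_eq r_distr r_minus)
    then have "y [^] m \<otimes> (zmult k \<otimes> t) \<in> V" using yw by simp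
    moreover have "y [^] m \<otimes> (zmult k \<otimes> t) = c' \<otimes> (y [^] (m + m') \<otimes> t)"
      unfolding c'(2) using c'(1) t y(1) by (simp add: nat_pow_mult[symmetric] m_ac)
    ultimately have "y [^] (m + m') \<otimes> t \<in> V"
      using E_cancel[OF C_sub_E[OF c'(1)]] t y(1) by simp
    then show "\<exists>n::nat. y [^] n \<otimes> t \<in> V" by blast
  qed
qed

lemma (in domain) zmult_injective:
  assumes char0: "\<And>m. m > 0 \<Longrightarrow> zmult (int m) \<noteq> \<zero>" and "zmult i = \<zero>"
  shows "i = 0"
proof (rule ccontr)
  assume "i \<noteq> 0"
  have "zmult (int (nat \<bar>i\<bar>)) = \<zero>" using assms(2) by (cases "i \<ge> 0") (auto simp: add.int_pow_neg)
  then show False using char0[of "nat \<bar>i\<bar>"] \<open>i \<noteq> 0\<close> by simp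
qed

text \<open>Here x lies in the Jacobson radical. Unless some unit is transcendental over the integers,
  x divides a nonzero integer n; then R has characteristic 0 and every prime factor of n + 1
  is a unit, and its valuation on the rationals yields a maximal subring.\<close>

lemma (in domain) maximal_subring_if_radical_element:
  assumes x: "x \<in> carrier R" "x \<noteq> \<zero>"
    and unit: "\<And>d. d \<in> carrier R \<Longrightarrow> \<exists>e\<in>carrier R. (\<one> \<oplus> x \<otimes> d) \<otimes> e = \<one>"
  shows "\<exists>S. maximal_subring S R"
proof (rule ccontr)
  let ?Z = integer_multiples
  note Z = subring_integer_multiples
  have ZC: "?Z \<subseteq> carrier R" using subringE(1)[OF Z] .
  assume no: "\<not> ?thesis"
  have alg: "\<not> free_over ?Z (\<one> \<oplus> x \<otimes> d)" if d: "d \<in> carrier R" for d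
  proof -
    have "\<one> \<oplus> x \<otimes> d \<in> carrier R" using x d by simp
    moreover obtain e where "e \<in> carrier R" "(\<one> \<oplus> x \<otimes> d) \<otimes> e = \<one>" using unit d by blast
    ultimately show ?thesis using maximal_subring_if_free_unit[OF _ _ _ Z] no by blast
  qed
  have "\<exists>n d. n \<in> ?Z \<and> n \<noteq> \<zero> \<and> d \<in> carrier R \<and> n = x \<otimes> d"
  proof -
    have "\<not> free_over ?Z (\<one> \<oplus> x)" using alg[of \<one>] x by simp
    from not_free_overE[OF this ZC] x obtain a p where
      "a \<in> ?Z" "a \<noteq> \<zero>" "set p \<subseteq> ?Z" "eval (a # p) (\<one> \<oplus> x) = \<zero>" by auto
    then show ?thesis by (rule multiple_in_subring_if_algebraic[OF Z x])
  qed
  then obtain k0 d0 where k0: "zmult k0 \<noteq> \<zero>" "d0 \<in> carrier R" "zmult k0 = x \<otimes> d0"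
    unfolding integer_multiples_def by blast
  obtain k d where k: "zmult k \<noteq> \<zero>" "d \<in> carrier R" "zmult k = x \<otimes> d" "k > 0"
  proof (cases "k0 > 0")
    case False
    have "k0 \<noteq> 0" using k0(1) zmult_0 by metis
    moreover have "zmult (- k0) = x \<otimes> (\<ominus> d0)" "zmult (- k0) \<noteq> \<zero>"
      using k0 x by (auto simp: add.int_pow_neg r_minus)
    ultimately show thesis using that[of "- k0" "\<ominus> d0"] k0(2) False by simp
  qed (use that k0 in blast)
  \<comment> \<open>In positive characteristic k would be invertible, hence also x, and a suitable
    d' would turn the unit \<open>\<one> \<oplus> x \<otimes> d'\<close> into zero.\<close>
  have char0: "zmult (int m) \<noteq> \<zero>" if m: "m > 0" for m
  proof
    assume "zmult (int m) = \<zero>"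
    then obtain b where b: "zmult b \<otimes> zmult k = \<one>" using coprime_to_characteristic[OF k(1) m] by blast
    define d' where "d' = d \<otimes> \<ominus> zmult b"
    have d': "d' \<in> carrier R" unfolding d'_def using k(2) by simp
    have "x \<otimes> d' = \<ominus> (zmult b \<otimes> (x \<otimes> d))"
      unfolding d'_def using x k(2) by (simp add: r_minus m_ac)
    then have "x \<otimes> d' = \<ominus> \<one>" using b k(3) by simp
    then have z: "\<one> \<oplus> x \<otimes> d' = \<zero>" by (simp add: r_neg)
    obtain e where "e \<in> carrier R" "(\<one> \<oplus> x \<otimes> d') \<otimes> e = \<one>" using unit[OF d'] by blast
    then show False unfolding z by simp
  qed
  \<comment> \<open>Positivity of k ensures a prime factor of k + 1. It is invertible because k + 1
    is the unit \<open>\<one> \<oplus> x \<otimes> d\<close>.\<close>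
  have "nat (k + 1) \<noteq> 1" using k(4) by simp
  then obtain q0 where q0: "Factorial_Ring.prime q0" "q0 dvd nat (k + 1)" using prime_factor_nat by blast
  define q where "q = int q0"
  have q: "Factorial_Ring.prime q" "q dvd k + 1"
    using q0 k(4) int_dvd_int_iff[of q0 "nat (k + 1)"] unfolding q_def by auto
  from q(2) obtain s where s: "k + 1 = q * s" by (elim dvdE)
  obtain e where e: "e \<in> carrier R" "(\<one> \<oplus> x \<otimes> d) \<otimes> e = \<one>" using unit k(2) by blast
  have "zmult (k + 1) = \<one> \<oplus> x \<otimes> d" using k(2,3) x by (simp add: add.int_pow_mult a_comm)
  then have qs: "zmult q \<otimes> zmult s = \<one> \<oplus> x \<otimes> d" unfolding s int_mult_one_mult by simp
  have xi: "zmult s \<otimes> e \<in> carrier R" using e(1) by simp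
  have "zmult s \<otimes> e \<otimes> zmult q = (zmult q \<otimes> zmult s) \<otimes> e" using e(1) by (simp add: m_ac)
  then have "zmult s \<otimes> e \<otimes> zmult q = \<one>" unfolding qs using e(2) by simp
  moreover have "\<not> free_over ?Z (\<one> \<oplus> zmult k \<otimes> t)" if "t \<in> carrier R" for t
    using alg[of "d \<otimes> t"] that k(2,3) x(1) by (simp add: m_assoc)
  ultimately show False
    using maximal_subring_if_prime_unit[OF zmult_injective[OF char0] q(1) xi _ k(1)] no by blast
qed

text \<open>All nonzero elements are units, so every element is algebraic over the prime subring.
  Characteristic 0 is excluded because 2 would be an invertible prime. Over a finite prime field the
  powers of b lie in a finite span and must repeat.\<close>

lemma (in field) power_eq_one_if_no_maximal_subring:
  assumes no: "\<not> (\<exists>S. maximal_subring S R)" and b: "b \<in> carrier R" "b \<noteq> \<zero>"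
  shows "\<exists>n. n > 0 \<and> b [^] (n::nat) = \<one>"
proof -
  let ?Z = integer_multiples
  note Z = subring_integer_multiples
  have ZC: "?Z \<subseteq> carrier R" using subringE(1)[OF Z] .
  have unit: "\<exists>y\<in>carrier R. x \<otimes> y = \<one>" if "x \<in> carrier R" "x \<noteq> \<zero>" for x
    using that field_Units Units_r_inv_ex by auto
  have alg: "\<not> free_over ?Z x" if x: "x \<in> carrier R" for x
  proof (cases "x = \<zero>")
    case True
    have "eval [\<one>, \<zero>] x = \<zero>" using True by simp
    moreover have "set [\<one>, \<zero>] \<subseteq> ?Z" using subringE(2,3)[OF Z] by simp
    ultimately show ?thesis using free_overD[of ?Z x "[\<one>, \<zero>]"] by auto
  next
    case False
    then obtain y where "y \<in> carrier R" "x \<otimes> y = \<one>" using unit[OF x] by blast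
    then show ?thesis using maximal_subring_if_free_unit[OF x _ _ Z] no by blast
  qed
  have "\<exists>m>0. zmult (int m) = \<zero>"
  proof (rule ccontr)
    assume "\<not> ?thesis"
    then have inj: "i = 0" if "zmult i = \<zero>" for i using zmult_injective that by blast
    obtain xi where xi: "xi \<in> carrier R" "zmult 2 \<otimes> xi = \<one>"
      using unit[of "zmult 2"] inj[of 2] by auto
    then have "xi \<otimes> zmult 2 = \<one>" by (simp add: m_comm)
    moreover have "\<not> free_over ?Z (\<one> \<oplus> zmult 1 \<otimes> t)" if "t \<in> carrier R" for t
      using alg that by simp
    moreover have "Factorial_Ring.prime (2::int)" by simp
    moreover have "zmult 1 \<noteq> \<zero>" by simp
    ultimately show False using maximal_subring_if_prime_unit[OF inj, of 2 xi 1] xi(1) no by blast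
  qed
  then obtain m where m: "m > 0" "zmult (int m) = \<zero>" by blast
  have "?Z \<subseteq> zmult ` {0..<int m}"
  proof
    fix z assume "z \<in> ?Z"
    then obtain i where i: "z = zmult i" unfolding integer_multiples_def by blast
    have "zmult i = zmult (int m * (i div int m) + i mod int m)" by simp
    also have "\<dots> = zmult (int m) \<otimes> zmult (i div int m) \<oplus> zmult (i mod int m)"
      unfolding int_mult_one_mult by (rule add.int_pow_mult) simp
    also have "\<dots> = zmult (i mod int m)" using m(2) by simp
    finally show "z \<in> zmult ` {0..<int m}" using m(1) unfolding i by (intro image_eqI) auto
  qed
  then have finZ: "finite ?Z" by (rule finite_subset) simp
  from not_free_overE[OF alg[OF b(1)] ZC b(1)] obtain a p where
    ap: "a \<in> ?Z" "a \<noteq> \<zero>" "set p \<subseteq> ?Z" "eval (a # p) b = \<zero>" by blast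
  then obtain l where l: "a = zmult l" unfolding integer_multiples_def by blast
  obtain c where c: "zmult c \<otimes> a = \<one>" using coprime_to_characteristic[OF _ m] ap(2) unfolding l by blast
  have cZ: "zmult c \<in> ?Z" unfolding integer_multiples_def by blast
  define q where "q = map ((\<otimes>) (zmult c)) p"
  have q: "set q \<subseteq> ?Z" using ap(3) cZ subringE(6)[OF Z] unfolding q_def by auto
  have "set (a # p) \<subseteq> carrier R" using ap(1,3) ZC by auto
  from eval_map_mult[OF _ b(1) this, of "zmult c"] ap(4)
  have ev: "eval (\<one> # q) b = \<zero>" unfolding q_def using c by simp
  have "p \<noteq> []" using ap subsetD[OF ZC] by auto
  then obtain k where k: "length q = Suc k" unfolding q_def by (cases p) auto
  interpret cring_subring R ?Z
    by (intro cring_subring.intro cring_subring_axioms.intro Z is_cring)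
  \<comment> \<open>The relation has been made monic, so the span of 1, ..., b^k is stable under
    multiplication by b.\<close>
  have top: "\<one> \<otimes> b [^] Suc k \<in> pspan b (Suc k)" by (rule pspan_top[OF b(1) _ q k ev]) simp
  have powers: "b [^] n \<in> pspan b (Suc k)" for n :: nat
  proof (induct n)
    case 0
    show ?case using pspan_pow[OF b(1), of 0 "Suc k" \<one>] by (simp del: pspan.simps)
  next
    case (Suc n)
    then have "\<one> \<otimes> b \<otimes> b [^] n \<in> pspan b (Suc k)" by (intro pspan_mult_closed[OF b(1) _ top]) simp_all
    then show ?case using b(1) by (simp add: m_comm del: pspan.simps)
  qed
  have "finite (range (\<lambda>n::nat. b [^] n))"
    by (rule finite_subset[OF _ finite_pspan[OF b(1) finZ, of "Suc k"]]) (use powers in blast)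
  then have "\<not> inj (\<lambda>n::nat. b [^] n)" using finite_imageD infinite_UNIV_nat by blast
  then obtain i j :: nat where "b [^] i = b [^] j" "i \<noteq> j" by (auto simp: inj_on_def)
  then obtain i j :: nat where ij: "b [^] i = b [^] j" "i < j" by (metis nat_neq_iff)
  have "b [^] i \<otimes> b [^] (j - i) = b [^] j" using ij(2) b(1) by (simp add: nat_pow_mult)
  then have "b [^] i \<otimes> b [^] (j - i) = b [^] i \<otimes> \<one>" using ij(1) b(1) by simp
  moreover have "b [^] i \<noteq> \<zero>" using b nat_pow_zero by (induct i) (auto simp: integral_iff)
  ultimately have "b [^] (j - i) = \<one>" using b(1) by (subst (asm) m_lcancel) simp_all
  then show ?thesis using ij(2) by (intro exI[of _ "j - i"]) simp
qed

text \<open>The Hilbert ring property. A prime P above I missing x would make the image of x a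
  nonzero element of the Jacobson radical of the domain R/P, which would then have a maximal
  subring.\<close>

lemma (in cring) power_in_ideal_if_in_maximal_ideals:
  assumes no: "\<not> (\<exists>S. maximal_subring S R)" and x: "x \<in> carrier R"
    and I: "ideal I R" and rad: "\<And>M. maximalideal M R \<Longrightarrow> I \<subseteq> M \<Longrightarrow> x \<in> M"
  shows "\<exists>n::nat. x [^] n \<in> I"
proof (rule ccontr)
  assume "\<nexists>n::nat. x [^] n \<in> I"
  then obtain P where P: "primeideal P R" "I \<subseteq> P" "x \<notin> P"
    using exists_prime_ideal_avoiding_powers[OF I x] by blast
  interpret P: primeideal P R by fact
  interpret D: domain "R Quot P" by (rule P.quotient_is_domain)
  interpret h: ring_hom_ring R "R Quot P" "(+>) P" by (rule P.rcos_ring_hom_ring)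
  have "\<exists>S. maximal_subring S (R Quot P)"
  proof (rule D.maximal_subring_if_radical_element)
    show "P +> x \<in> carrier (R Quot P)" using x by simp
    show "P +> x \<noteq> \<zero>\<^bsub>R Quot P\<^esub>"
      using P(3) x P.a_rcos_self by (metis FactRing_def ring.simps(1))
    fix d assume "d \<in> carrier (R Quot P)"
    then obtain r where r: "r \<in> carrier R" "d = P +> r" unfolding carrier_FactRing by blast
    let ?u = "\<one> \<oplus> x \<otimes> r"
    have u: "?u \<in> carrier R" using x r by simp
    \<comment> \<open>A maximal ideal above P contains x; containing 1 + x r too, it would contain
      1. So 1 + x r is invertible modulo P.\<close>
    have "\<not> PIdl ?u \<subseteq> M" if M: "maximalideal M R" "P \<subseteq> M" for M
    proof
      assume sub: "PIdl ?u \<subseteq> M"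
      interpret M: maximalideal M R by fact
      have "?u \<in> M" "I \<subseteq> M" using sub cgenideal_self[OF u] P(2) M(2) by blast+
      moreover have "x \<otimes> r \<in> M" using rad[OF M(1) \<open>I \<subseteq> M\<close>] r M.I_r_closed by blast
      ultimately have "?u \<ominus> x \<otimes> r \<in> M" by (simp add: minus_eq)
      moreover have "?u \<ominus> x \<otimes> r = \<one>" using x r by algebra
      ultimately show False using M.one_imp_carrier M.I_notcarr by simp
    qed
    then obtain p j where pj: "p \<in> P" "j \<in> PIdl ?u" "p \<oplus> j = \<one>"
      using comaximal_if_no_common_maximal_ideal[OF P.is_ideal cgenideal_ideal[OF u]] by blast
    then obtain e where e: "e \<in> carrier R" "j = e \<otimes> ?u" unfolding cgenideal_def by blast
    have pc: "p \<in> carrier R" using pj(1) P.Icarr by blast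
    have "\<one> \<ominus> ?u \<otimes> e = p"
    proof -
      have "\<one> \<ominus> ?u \<otimes> e = (p \<oplus> e \<otimes> ?u) \<ominus> ?u \<otimes> e" using pj(3) e(2) by simp
      also have "\<dots> = p" using pc e(1) x r by algebra
      finally show ?thesis .
    qed
    then have "P +> \<one> = P +> (?u \<otimes> e)"
      using quotient_eq_iff_same_a_r_cos[OF P.is_ideal one_closed, of "?u \<otimes> e"] pj(1) u e(1) by simp
    then have "(P +> ?u) \<otimes>\<^bsub>R Quot P\<^esub> (P +> e) = \<one>\<^bsub>R Quot P\<^esub>"
      using u e(1) h.hom_mult[of ?u e] h.hom_one by simp
    moreover have "P +> ?u = \<one>\<^bsub>R Quot P\<^esub> \<oplus>\<^bsub>R Quot P\<^esub> (P +> x) \<otimes>\<^bsub>R Quot P\<^esub> d"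
      using x r by simp
    ultimately show "\<exists>e\<in>carrier (R Quot P). (\<one>\<^bsub>R Quot P\<^esub> \<oplus>\<^bsub>R Quot P\<^esub> (P +> x) \<otimes>\<^bsub>R Quot P\<^esub> d)
        \<otimes>\<^bsub>R Quot P\<^esub> e = \<one>\<^bsub>R Quot P\<^esub>" using e(1) h.hom_closed by metis
  qed
  then show False using no maximal_subring_quotientD[OF P.is_ideal] by blast
qed

section \<open>Isomorphic residue fields\<close>

lemma maximalideal_unique:
  assumes "maximalideal M R" "maximalideal N R" "M \<subseteq> N" shows "M = N"
proof -
  interpret M: maximalideal M R by fact
  interpret N: maximalideal N R by fact
  show ?thesis using M.I_maximal[OF N.is_ideal assms(3) N.a_subset] N.I_notcarr by blast
qed

lemma (in cring) maximal_ideal_comaximal: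
  assumes M: "maximalideal M R" and J: "ideal J R" and "\<not> J \<subseteq> M"
  shows "\<exists>m\<in>M. \<exists>j\<in>J. m \<oplus> j = \<one>"
  using comaximal_if_no_common_maximal_ideal[OF maximalideal.axioms(1)[OF M] J]
    maximalideal_unique[OF M] assms(3) by blast

text \<open>A numbering of R/I, given on representatives so that computations with cosets take place
  in R. It exists exactly when R/I is countable.\<close>

definition separates_cosets :: "('a, 'b) ring_scheme \<Rightarrow> 'a set \<Rightarrow> ('a \<Rightarrow> nat) \<Rightarrow> bool" where
  "separates_cosets R I g \<longleftrightarrow>
    (\<forall>a\<in>carrier R. \<forall>b\<in>carrier R. g a = g b \<longleftrightarrow> a \<ominus>\<^bsub>R\<^esub> b \<in> I)"

text \<open>The ring structure transported from R/I to the natural numbers along g.\<close>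

definition quotient_code :: "('a, 'b) ring_scheme \<Rightarrow> ('a \<Rightarrow> nat) \<Rightarrow> (nat \<times> nat \<times> nat \<times> nat) set" where
  "quotient_code R g = {(0, g a, g b, g (a \<oplus>\<^bsub>R\<^esub> b)) | a b. a \<in> carrier R \<and> b \<in> carrier R}
    \<union> {(1, g a, g b, g (a \<otimes>\<^bsub>R\<^esub> b)) | a b. a \<in> carrier R \<and> b \<in> carrier R}
    \<union> {(2, g a, g (\<ominus>\<^bsub>R\<^esub> a), 0) | a. a \<in> carrier R} \<union> {(3, g \<one>\<^bsub>R\<^esub>, 0, 0)}"

lemma (in cring) separates_cosetsD:
  assumes "separates_cosets R I g" "a \<in> carrier R" "b \<in> carrier R"
  shows "g a = g b \<longleftrightarrow> a \<ominus> b \<in> I"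
  using assms unfolding separates_cosets_def by blast

lemma (in cring) separates_cosets_cong:
  assumes I: "ideal I R" and g: "separates_cosets R I g"
    and c: "a \<in> carrier R" "b \<in> carrier R" "a' \<in> carrier R" "b' \<in> carrier R"
    and eq: "g a = g a'" "g b = g b'"
  shows "g (a \<oplus> b) = g (a' \<oplus> b')" "g (a \<otimes> b) = g (a' \<otimes> b')" "g (\<ominus> a) = g (\<ominus> a')"
proof -
  interpret ideal I R by fact
  have ab: "a \<ominus> a' \<in> I" "b \<ominus> b' \<in> I" using eq separates_cosetsD[OF g] c by auto
  have "(a \<oplus> b) \<ominus> (a' \<oplus> b') = (a \<ominus> a') \<oplus> (b \<ominus> b')" using c by algebra
  then show "g (a \<oplus> b) = g (a' \<oplus> b')" using ab separates_cosetsD[OF g] c by simp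
  have "(a \<otimes> b) \<ominus> (a' \<otimes> b') = (a \<ominus> a') \<otimes> b \<oplus> a' \<otimes> (b \<ominus> b')" using c by algebra
  then show "g (a \<otimes> b) = g (a' \<otimes> b')"
    using ab separates_cosetsD[OF g] c I_l_closed I_r_closed by simp
  have "(\<ominus> a) \<ominus> (\<ominus> a') = \<ominus> (a \<ominus> a')" using c by algebra
  then show "g (\<ominus> a) = g (\<ominus> a')" using ab separates_cosetsD[OF g] c by simp
qed

text \<open>The subring below is the preimage of the diagonal under
  R \<rightarrow> R/M \<times> R/N, where the two quotients are the same field.\<close>

lemma (in cring) maximal_subring_if_equal_codes:
  assumes M: "maximalideal M R" and N: "maximalideal N R" and "M \<noteq> N"
    and g: "separates_cosets R M g" and h: "separates_cosets R N h"
    and code: "quotient_code R g = quotient_code R h"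
  shows "\<exists>S. maximal_subring S R"
proof -
  interpret M: maximalideal M R by fact
  interpret N: maximalideal N R by fact
  note gc = separates_cosets_cong[OF M.is_ideal g] and hc = separates_cosets_cong[OF N.is_ideal h]
  note gD = separates_cosetsD[OF g] and hD = separates_cosetsD[OF h]
  have ex_add: "\<exists>a'\<in>carrier R. \<exists>b'\<in>carrier R. g a = h a' \<and> g b = h b' \<and> g (a \<oplus> b) = h (a' \<oplus> b')"
    if "a \<in> carrier R" "b \<in> carrier R" for a b
  proof -
    have "(0, g a, g b, g (a \<oplus> b)) \<in> quotient_code R g" using that unfolding quotient_code_def by blast
    then show ?thesis unfolding code by (auto simp: quotient_code_def)
  qed
  have ex_mult: "\<exists>a'\<in>carrier R. \<exists>b'\<in>carrier R. g a = h a' \<and> g b = h b' \<and> g (a \<otimes> b) = h (a' \<otimes> b')"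
    if "a \<in> carrier R" "b \<in> carrier R" for a b
  proof -
    have "(1, g a, g b, g (a \<otimes> b)) \<in> quotient_code R g" using that unfolding quotient_code_def by blast
    then show ?thesis unfolding code by (auto simp: quotient_code_def)
  qed
  have ex_neg: "\<exists>a'\<in>carrier R. g a = h a' \<and> g (\<ominus> a) = h (\<ominus> a')" if "a \<in> carrier R" for a
  proof -
    have "(2, g a, g (\<ominus> a), 0) \<in> quotient_code R g" using that unfolding quotient_code_def by blast
    then show ?thesis unfolding code by (auto simp: quotient_code_def)
  qed
  have gh1: "g \<one> = h \<one>"
  proof -
    have "(3, g \<one>, 0, 0) \<in> quotient_code R g" unfolding quotient_code_def by blast
    then show ?thesis unfolding code by (auto simp: quotient_code_def)
  qed
  have ex_h: "\<exists>a\<in>carrier R. g a = h r" if "r \<in> carrier R" for r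
  proof -
    have "(0, h r, h r, h (r \<oplus> r)) \<in> quotient_code R h" using that unfolding quotient_code_def by blast
    then show ?thesis unfolding code[symmetric] by (auto simp: quotient_code_def)
  qed
  define S where "S = {a \<in> carrier R. g a = h a}"
  have S: "subring S R"
  proof (rule subringI)
    show "S \<subseteq> carrier R" "\<one> \<in> S" unfolding S_def using gh1 by auto
    fix a assume a: "a \<in> S"
    obtain a' where a': "a' \<in> carrier R" "g a = h a'" "g (\<ominus> a) = h (\<ominus> a')"
      using ex_neg a unfolding S_def by blast
    have "h (\<ominus> a') = h (\<ominus> a)"
      using a a' unfolding S_def by (intro hc(3)[where b = \<one> and b' = \<one>]) auto
    then show "\<ominus> a \<in> S" using a a' unfolding S_def by simp
    fix b assume b: "b \<in> S"
    obtain c d where cd: "c \<in> carrier R" "d \<in> carrier R" "g a = h c" "g b = h d"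
        "g (a \<oplus> b) = h (c \<oplus> d)"
      using ex_add a b unfolding S_def by blast
    have "h (c \<oplus> d) = h (a \<oplus> b)" using a b cd unfolding S_def by (intro hc(1)) auto
    then show "a \<oplus> b \<in> S" using a b cd unfolding S_def by simp
    obtain c d where cd: "c \<in> carrier R" "d \<in> carrier R" "g a = h c" "g b = h d"
        "g (a \<otimes> b) = h (c \<otimes> d)"
      using ex_mult a b unfolding S_def by blast
    have "h (c \<otimes> d) = h (a \<otimes> b)" using a b cd unfolding S_def by (intro hc(2)) auto
    then show "a \<otimes> b \<in> S" using a b cd unfolding S_def by simp
  qed
  have notsub: "\<not> M \<subseteq> N" "\<not> N \<subseteq> M"
    using maximalideal_unique[OF M N] maximalideal_unique[OF N M] \<open>M \<noteq> N\<close> by auto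
  obtain m n where mn: "m \<in> M" "n \<in> N" "m \<oplus> n = \<one>"
    using maximal_ideal_comaximal[OF M N.is_ideal notsub(2)] by blast
  have mnc: "m \<in> carrier R" "n \<in> carrier R" using mn M.Icarr N.Icarr by auto
  have crt: "\<exists>c\<in>carrier R. g c = g a \<and> h c = h b" if ab: "a \<in> carrier R" "b \<in> carrier R" for a b
  proof -
    let ?c = "a \<otimes> n \<oplus> b \<otimes> m"
    have "?c \<ominus> a = ?c \<ominus> a \<otimes> (m \<oplus> n)" using mn(3) ab by simp
    also have "\<dots> = (b \<ominus> a) \<otimes> m" using ab mnc by algebra
    finally have 1: "?c \<ominus> a \<in> M" using M.I_l_closed mn(1) ab by simp
    have "?c \<ominus> b = ?c \<ominus> b \<otimes> (m \<oplus> n)" using mn(3) ab by simp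
    also have "\<dots> = (a \<ominus> b) \<otimes> n" using ab mnc by algebra
    finally have 2: "?c \<ominus> b \<in> N" using N.I_l_closed mn(2) ab by simp
    have "?c \<in> carrier R" using ab mnc by simp
    then show ?thesis using gD[of ?c a] hD[of ?c b] ab 1 2 by blast
  qed
  \<comment> \<open>\<open>S\<close> maps onto R/N, so R is the sum of \<open>S\<close> and N; a
    subring above \<open>S\<close> is therefore all of R once it contains N.\<close>
  have lift_h: "\<exists>s\<in>S. h s = h r" if r: "r \<in> carrier R" for r
  proof -
    obtain a where a: "a \<in> carrier R" "g a = h r" using ex_h r by blast
    obtain c where "c \<in> carrier R" "g c = g a" "h c = h r" using crt a(1) r by blast
    then show ?thesis using a unfolding S_def by auto
  qed
  have lift_g: "\<exists>s\<in>S. g s = g r" if r: "r \<in> carrier R" for r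
  proof -
    obtain a where a: "a \<in> carrier R" "g r = h a" using ex_add[OF r r] by blast
    obtain c where "c \<in> carrier R" "g c = g r" "h c = h a" using crt r a(1) by blast
    then show ?thesis using a unfolding S_def by auto
  qed
  have zero_S: "\<zero> \<in> S" using subringE(2)[OF S] .
  have MN: "w \<in> S" if w: "w \<in> M" "w \<in> N" for w
  proof -
    have wc: "w \<in> carrier R" using w M.Icarr by blast
    have "w \<ominus> \<zero> = w" using wc by algebra
    then have "g w = g \<zero>" "h w = h \<zero>" using gD[of w \<zero>] hD[of w \<zero>] wc w by auto
    then show ?thesis using zero_S wc unfolding S_def by simp
  qed
  have "S \<noteq> carrier R"
  proof
    assume "S = carrier R"
    then have "m \<in> S" using mnc by simp
    moreover have "m \<ominus> \<zero> = m" using mnc by algebra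
    ultimately have "h m = h \<zero>" using gD[of m \<zero>] mnc mn(1) zero_S unfolding S_def by auto
    then have "m \<in> N" using hD[of m \<zero>] mnc \<open>m \<ominus> \<zero> = m\<close> by simp
    then have "m \<oplus> n \<in> N" using mn(2) by simp
    then show False using mn(3) N.one_imp_carrier N.I_notcarr by simp
  qed
  moreover have "W = S" if W: "subring W R" "S \<subseteq> W" "W \<noteq> carrier R" for W
  proof (rule ccontr)
    assume "W \<noteq> S"
    note WE = subringE[OF W(1)]
    have Wminus: "a \<ominus> b \<in> W" if "a \<in> W" "b \<in> W" for a b
      using that WE(5,7) by (simp add: minus_eq)
    obtain t where t: "t \<in> W" "t \<notin> S" using \<open>W \<noteq> S\<close> W(2) by blast
    have tc: "t \<in> carrier R" using t(1) WE(1) by blast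
    obtain s0 where s0: "s0 \<in> S" "h s0 = h t" using lift_h[OF tc] by blast
    have s0c: "s0 \<in> carrier R" "g s0 = h s0" using s0(1) unfolding S_def by auto
    \<comment> \<open>Correcting t by an element of the diagonal with the same residue at N gives an
      element of W that vanishes at N but not at M.\<close>
    define e where "e = t \<ominus> s0"
    have ec: "e \<in> carrier R" and eW: "e \<in> W"
      unfolding e_def using tc s0c Wminus t(1) s0(1) W(2) by auto
    have eN: "e \<in> N" unfolding e_def using hD[of t s0] tc s0c s0(2) by simp
    have eM: "e \<notin> M"
    proof
      assume "e \<in> M"
      then have "g t = g s0" unfolding e_def using gD[of t s0] tc s0c by simp
      then show False using t(2) tc s0(2) s0c unfolding S_def by simp
    qed
    have "\<not> PIdl e \<subseteq> M" using eM cgenideal_self[OF ec] by blast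
    then obtain p j where pj: "p \<in> M" "j \<in> PIdl e" "p \<oplus> j = \<one>"
      using maximal_ideal_comaximal[OF M cgenideal_ideal[OF ec]] by blast
    then obtain r where r: "r \<in> carrier R" "j = r \<otimes> e" unfolding cgenideal_def by blast
    have pc: "p \<in> carrier R" using pj(1) M.Icarr by blast
    \<comment> \<open>Modulo M the element r inverts e. Choosing r' in \<open>S\<close> with the
      residue of v r at M, the product e r' in W agrees with v modulo both M and N, and
      \<open>S\<close> contains their intersection.\<close>
    have NW: "v \<in> W" if v: "v \<in> N" for v
    proof -
      have vc: "v \<in> carrier R" using v N.Icarr by blast
      obtain r' where r': "r' \<in> S" "g r' = g (v \<otimes> r)" using lift_g vc r(1) by blast
      have r'c: "r' \<in> carrier R" using r'(1) unfolding S_def by blast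
      have "v \<otimes> r \<ominus> r' \<in> M" using r'(2) gD[of "v \<otimes> r" r'] r'c vc r(1) by simp
      then have "v \<otimes> p \<oplus> e \<otimes> (v \<otimes> r \<ominus> r') \<in> M"
        using pj(1) M.I_l_closed vc ec by simp
      moreover have "v \<otimes> (p \<oplus> r \<otimes> e) \<ominus> e \<otimes> r' = v \<otimes> p \<oplus> e \<otimes> (v \<otimes> r \<ominus> r')"
        using vc pc r(1) ec r'c by algebra
      then have "v \<ominus> e \<otimes> r' = v \<otimes> p \<oplus> e \<otimes> (v \<otimes> r \<ominus> r')"
        using pj(3) vc unfolding r(2) by simp
      ultimately have inM: "v \<ominus> e \<otimes> r' \<in> M" by simp
      have "v \<ominus> e \<otimes> r' \<in> N" using v N.I_r_closed[OF eN r'c] by (simp add: minus_eq)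
      then have "v \<ominus> e \<otimes> r' \<in> W" using MN inM W(2) by blast
      moreover have "e \<otimes> r' \<in> W" using eW r'(1) W(2) WE(6) by blast
      ultimately have "(v \<ominus> e \<otimes> r') \<oplus> e \<otimes> r' \<in> W" using WE(7) by blast
      moreover have "(v \<ominus> e \<otimes> r') \<oplus> e \<otimes> r' = v" using vc ec r'c by algebra
      ultimately show ?thesis by simp
    qed
    have "u \<in> W" if u: "u \<in> carrier R" for u
    proof -
      obtain s where s: "s \<in> S" "h s = h u" using lift_h[OF u] by blast
      have sc: "s \<in> carrier R" using s(1) unfolding S_def by blast
      have "u \<ominus> s \<in> W" using NW hD[of u s] u sc s(2) by simp
      then have "(u \<ominus> s) \<oplus> s \<in> W" using s(1) W(2) WE(7) by blast
      moreover have "(u \<ominus> s) \<oplus> s = u" using u sc by algebra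
      ultimately show ?thesis by simp
    qed
    then show False using W(3) WE(1) by blast
  qed
  ultimately show ?thesis using S unfolding maximal_subring_def by blast
qed

lemma (in cring) exists_separating_map:
  assumes no: "\<not> (\<exists>S. maximal_subring S R)" and M: "maximalideal M R"
  shows "\<exists>g. separates_cosets R M g"
proof -
  interpret M: maximalideal M R by fact
  interpret F: field "R Quot M" by (rule M.quotient_is_field[OF is_cring])
  have cnt: "countable (carrier (R Quot M))"
    using F.maximal_subring_if_uncountable maximal_subring_quotientD[OF M.is_ideal] no by blast
  have "separates_cosets R M (\<lambda>a. to_nat_on (carrier (R Quot M)) (M +> a))"
    unfolding separates_cosets_def
  proof (intro ballI)
    fix a b assume ab: "a \<in> carrier R" "b \<in> carrier R"
    then have "M +> a \<in> carrier (R Quot M)" "M +> b \<in> carrier (R Quot M)"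
      unfolding carrier_FactRing by auto
    then have "to_nat_on (carrier (R Quot M)) (M +> a) = to_nat_on (carrier (R Quot M)) (M +> b)
        \<longleftrightarrow> M +> a = M +> b"
      using cnt by simp
    then show "to_nat_on (carrier (R Quot M)) (M +> a) = to_nat_on (carrier (R Quot M)) (M +> b)
        \<longleftrightarrow> a \<ominus> b \<in> M"
      using quotient_eq_iff_same_a_r_cos[OF M.is_ideal ab] by simp
  qed
  then show ?thesis by blast
qed

lemma (in cring) power_minus_one_in_maximal_ideal:
  assumes no: "\<not> (\<exists>S. maximal_subring S R)" and M: "maximalideal M R"
    and b: "b \<in> carrier R" "b \<notin> M"
  shows "\<exists>n. n > 0 \<and> b [^] (n::nat) \<ominus> \<one> \<in> M"
proof -
  interpret M: maximalideal M R by fact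
  interpret F: field "R Quot M" by (rule M.quotient_is_field[OF is_cring])
  interpret h: ring_hom_ring R "R Quot M" "(+>) M" by (rule M.rcos_ring_hom_ring)
  have "M +> b \<in> carrier (R Quot M)" using b(1) by simp
  moreover have "M +> b \<noteq> \<zero>\<^bsub>R Quot M\<^esub>"
    using b M.a_rcos_self by (metis FactRing_def ring.simps(1))
  ultimately obtain n :: nat where n: "n > 0" "(M +> b) [^]\<^bsub>R Quot M\<^esub> n = \<one>\<^bsub>R Quot M\<^esub>"
    using F.power_eq_one_if_no_maximal_subring no maximal_subring_quotientD[OF M.is_ideal] by blast
  have "M +> (b [^] k) = (M +> b) [^]\<^bsub>R Quot M\<^esub> k" for k :: nat
    using b(1) by (induct k) (simp_all del: h.hom_one add: h.hom_one)
  then have "M +> (b [^] n) = M +> \<one>" using n(2) h.hom_one by simp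
  then show ?thesis using n(1) quotient_eq_iff_same_a_r_cos[OF M.is_ideal, of "b [^] n" \<one>] b(1) by auto
qed

section \<open>Small sets of maximal ideals\<close>

text \<open>The ring R modulo the intersection of Y has at most continuum many elements.\<close>

definition small_on :: "('a, 'b) ring_scheme \<Rightarrow> 'a set set \<Rightarrow> bool" where
  "small_on R Y \<longleftrightarrow> (\<exists>\<phi> :: 'a \<Rightarrow> nat set. \<forall>a\<in>carrier R. \<forall>b\<in>carrier R.
    \<phi> a = \<phi> b \<longrightarrow> (\<forall>M\<in>Y. a \<ominus>\<^bsub>R\<^esub> b \<in> M))"

lemma small_onI:
  fixes \<phi> :: "'a \<Rightarrow> nat set"
  assumes "\<And>a b M. a \<in> carrier R \<Longrightarrow> b \<in> carrier R \<Longrightarrow> \<phi> a = \<phi> b \<Longrightarrow> M \<in> Y \<Longrightarrow> a \<ominus>\<^bsub>R\<^esub> b \<in> M"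
  shows "small_on R Y"
  unfolding small_on_def using assms by blast

lemma small_on_mono: "small_on R Y \<Longrightarrow> Z \<subseteq> Y \<Longrightarrow> small_on R Z"
  unfolding small_on_def by (meson subsetD)

text \<open>A sequence of sets of numbers is packed into a single set by pairing each member with
  its index.\<close>

lemma small_on_UN:
  fixes Y :: "nat \<Rightarrow> 'a set set"
  assumes "\<And>i. small_on R (Y i)"
  shows "small_on R (\<Union>i. Y i)"
proof -
  obtain \<phi> :: "nat \<Rightarrow> 'a \<Rightarrow> nat set" where \<phi>: "\<And>i. \<forall>a\<in>carrier R. \<forall>b\<in>carrier R.
      \<phi> i a = \<phi> i b \<longrightarrow> (\<forall>M\<in>Y i. a \<ominus>\<^bsub>R\<^esub> b \<in> M)"
    using assms unfolding small_on_def by metis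
  define \<psi> where "\<psi> a = {prod_encode (i, m) | i m. m \<in> \<phi> i a}" for a
  have dec: "m \<in> \<phi> i a \<longleftrightarrow> prod_encode (i, m) \<in> \<psi> a" for i m a
    unfolding \<psi>_def by auto
  show ?thesis
  proof (rule small_onI[where \<phi> = \<psi>])
    fix a b M assume a: "a \<in> carrier R" "b \<in> carrier R" "\<psi> a = \<psi> b" and "M \<in> (\<Union>i. Y i)"
    then obtain i where i: "M \<in> Y i" by blast
    have "\<phi> i a = \<phi> i b" using a(3) dec by blast
    then show "a \<ominus>\<^bsub>R\<^esub> b \<in> M" using \<phi> a(1,2) i by blast
  qed
qed

lemma small_on_empty: "small_on R {}"
  unfolding small_on_def by simp

lemma small_on_countable_Union:
  assumes "countable F" "\<And>Y. Y \<in> F \<Longrightarrow> small_on R Y"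
  shows "small_on R (\<Union>F)"
proof (cases "F = {}")
  case False
  have "small_on R (\<Union>i. from_nat_into F i)"
    by (rule small_on_UN) (use assms(2) from_nat_into[OF False] in blast)
  then show ?thesis using range_from_nat_into[OF False assms(1)] by simp
qed (simp add: small_on_empty)

lemma small_on_Un: "small_on R Y \<Longrightarrow> small_on R Z \<Longrightarrow> small_on R (Y \<union> Z)"
  using small_on_countable_Union[of "{Y, Z}" R] by auto

lemma small_on_singleton: "separates_cosets R M g \<Longrightarrow> small_on R {M}"
  by (rule small_onI[where \<phi> = "\<lambda>a. {g a}"]) (auto simp: separates_cosets_def)

text \<open>Slot 0 records the length, since an empty entry leaves no trace in its own slot; entry i
  is therefore stored in slot i + 1.\<close>

definition encode_list :: "nat set list \<Rightarrow> nat set" where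
  "encode_list L = {prod_encode (0, length L)} \<union> {prod_encode (Suc i, m) | i m. i < length L \<and> m \<in> L ! i}"

lemma encode_list_inject: "encode_list L = encode_list L' \<longleftrightarrow> L = L'"
proof
  assume eq: "encode_list L = encode_list L'"
  have len: "prod_encode (0, n) \<in> encode_list L \<longleftrightarrow> n = length L" for n L
    unfolding encode_list_def by auto
  have mem: "prod_encode (Suc i, m) \<in> encode_list L \<longleftrightarrow> i < length L \<and> m \<in> L ! i" for i m L
    unfolding encode_list_def by auto
  have "length L = length L'" using len eq by metis
  moreover have "L ! i = L' ! i" if "i < length L" for i
    using mem[of i _ L] mem[of i _ L'] eq that \<open>length L = length L'\<close> by auto
  ultimately show "L = L'" by (rule nth_equalityI)
qed simp

text \<open>With one numbering fixed for each residue field, the operation tables determine the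
  maximal ideal by the diagonal construction. Such a table is a set of quadruples of
  numbers.\<close>

lemma (in cring) Max_ideals_lepoll:
  assumes no: "\<not> (\<exists>S. maximal_subring S R)"
  shows "lepoll (Max_ideals R) (UNIV :: nat set set)"
proof -
  define g where "g M = (SOME g. separates_cosets R M g)" for M
  have g: "separates_cosets R M (g M)" if "maximalideal M R" for M
    unfolding g_def using exists_separating_map[OF no that] by (rule someI_ex)
  have "inj_on (\<lambda>M. to_nat ` quotient_code R (g M)) (Max_ideals R)"
  proof (rule inj_onI)
    fix M N assume MN: "M \<in> Max_ideals R" "N \<in> Max_ideals R"
      and "to_nat ` quotient_code R (g M) = to_nat ` quotient_code R (g N)"
    then have eq: "quotient_code R (g M) = quotient_code R (g N)"
      by (simp add: inj_image_eq_iff[OF inj_to_nat])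
    have M: "maximalideal M R" "maximalideal N R" using MN unfolding Max_ideals_def by auto
    show "M = N"
      using maximal_subring_if_equal_codes[OF M _ g[OF M(1)] g[OF M(2)] eq] no by blast
  qed
  then show ?thesis unfolding lepoll_def by blast
qed

section \<open>Splitting closed sets that are not small\<close>

abbreviation max_above :: "('a, 'b) ring_scheme \<Rightarrow> 'a set \<Rightarrow> 'a set set" where
  "max_above R I \<equiv> {M \<in> Max_ideals R. I \<subseteq> M}"

lemma (in ring) idealI':
  assumes "N \<subseteq> carrier R" "\<zero> \<in> N" "\<And>a b. a \<in> N \<Longrightarrow> b \<in> N \<Longrightarrow> a \<oplus> b \<in> N"
    and "\<And>a r. a \<in> N \<Longrightarrow> r \<in> carrier R \<Longrightarrow> r \<otimes> a \<in> N"
    and "\<And>a r. a \<in> N \<Longrightarrow> r \<in> carrier R \<Longrightarrow> a \<otimes> r \<in> N"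
  shows "ideal N R"
proof (rule idealI[OF ring_axioms])
  show "subgroup N (add_monoid R)"
  proof (rule add.subgroupI)
    show "\<ominus> a \<in> N" if "a \<in> N" for a
      using assms(4)[OF that, of "\<ominus> \<one>"] that assms(1) by (auto simp: l_minus)
  qed (use assms in auto)
qed (use assms in auto)

lemma (in cring) max_above_adjoin:
  assumes "ideal I R" "t \<in> carrier R"
  obtains J where "ideal J R" "I \<subseteq> J" "t \<in> J" "max_above R J = {M \<in> max_above R I. t \<in> M}"
proof -
  have sub: "I \<union> {t} \<subseteq> carrier R"
    using assms ideal.Icarr[OF assms(1)] by blast
  let ?J = "Idl (I \<union> {t})"
  have self: "I \<union> {t} \<subseteq> ?J" by (rule genideal_self[OF sub])
  have "?J \<subseteq> M" if "maximalideal M R" "I \<subseteq> M" "t \<in> M" for M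
    using genideal_minimal[OF maximalideal.axioms(1)[OF that(1)], of "I \<union> {t}"] that(2,3) by blast
  then have "max_above R ?J = {M \<in> max_above R I. t \<in> M}"
    using self unfolding Max_ideals_def by blast
  then show thesis using that[of ?J] genideal_ideal[OF sub] self by blast
qed

text \<open>If Y = V(I) does not split, the elements vanishing outside a small part of Y form a maximal
  ideal N, and every element of N vanishes outside a finite union of small sets taken
  from a family indexed by Y. As Y has at most continuum many elements, Y is small.\<close>

lemma (in cring) split_not_small:
  assumes no: "\<not> (\<exists>S. maximal_subring S R)" and I: "ideal I R"
    and big: "\<not> small_on R (max_above R I)"
  shows "\<exists>J K. ideal J R \<and> ideal K R \<and> I \<subseteq> J \<and> I \<subseteq> K \<and> \<not> small_on R (max_above R J)
    \<and> \<not> small_on R (max_above R K) \<and> (\<exists>m\<in>J. \<exists>n\<in>K. m \<oplus> n = \<one>)"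
proof (rule ccontr)
  let ?split = "\<exists>J K. ideal J R \<and> ideal K R \<and> I \<subseteq> J \<and> I \<subseteq> K \<and> \<not> small_on R (max_above R J)
    \<and> \<not> small_on R (max_above R K) \<and> (\<exists>m\<in>J. \<exists>n\<in>K. m \<oplus> n = \<one>)"
  assume unsplit: "\<not> ?split"
  define Y where "Y = max_above R I"
  have YM: "maximalideal M R" "I \<subseteq> M" "M \<in> Max_ideals R" if "M \<in> Y" for M
    using that unfolding Y_def Max_ideals_def by auto
  have YI: "ideal M R" if "M \<in> Y" for M using maximalideal.axioms(1)[OF YM(1)[OF that]] .
  define D where "D t = {M \<in> Y. t \<notin> M}" for t
  define N where "N = {t \<in> carrier R. small_on R (D t)}"
  \<comment> \<open>Nonzero residues are roots of unity, so \<open>D t\<close> is covered by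
    countably many of these sets. The exponent 0 is excluded because t^0 - 1 vanishes
    everywhere.\<close>
  have dich: "\<exists>n>0. \<not> small_on R {M \<in> Y. t [^] (n::nat) \<ominus> \<one> \<in> M}"
    if t: "t \<in> carrier R" "t \<notin> N" for t
  proof (rule ccontr)
    assume a: "\<not> ?thesis"
    have "D t \<subseteq> (\<Union>n. {M \<in> Y. t [^] Suc n \<ominus> \<one> \<in> M})"
    proof
      fix M assume "M \<in> D t"
      then have M: "M \<in> Y" "t \<notin> M" unfolding D_def by auto
      obtain n :: nat where "n > 0" "t [^] n \<ominus> \<one> \<in> M"
        using power_minus_one_in_maximal_ideal[OF no YM(1)[OF M(1)] t(1) M(2)] by blast
      then show "M \<in> (\<Union>n. {M \<in> Y. t [^] Suc n \<ominus> \<one> \<in> M})"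
        using M(1) by (intro UN_I[of "n - 1"]) auto
    qed
    moreover have "small_on R (\<Union>n. {M \<in> Y. t [^] Suc n \<ominus> \<one> \<in> M})"
      by (rule small_on_UN) (use a in blast)
    ultimately show False using t small_on_mono unfolding N_def by blast
  qed
  \<comment> \<open>As t^n and t^n - 1 generate the unit ideal, both sets being big would be a
    splitting.\<close>
  have smallV: "small_on R {M \<in> Y. t \<in> M}"
    if t: "t \<in> carrier R" and n: "n > 0" and bigu: "\<not> small_on R {M \<in> Y. t [^] (n::nat) \<ominus> \<one> \<in> M}" for t n
  proof -
    obtain J where J: "ideal J R" "I \<subseteq> J" "t \<in> J" "max_above R J = {M \<in> Y. t \<in> M}"
      using max_above_adjoin[OF I t] unfolding Y_def by blast
    have uc: "t [^] n \<ominus> \<one> \<in> carrier R" using t by simp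
    obtain K where K: "ideal K R" "I \<subseteq> K" "t [^] n \<ominus> \<one> \<in> K"
      "max_above R K = {M \<in> Y. t [^] n \<ominus> \<one> \<in> M}"
      using max_above_adjoin[OF I uc] unfolding Y_def by blast
    interpret J: ideal J R by fact
    interpret K: ideal K R by fact
    have "t [^] (n - 1) \<otimes> t \<in> J" using J.I_l_closed[OF J(3)] t by simp
    moreover have "t [^] (n - 1) \<otimes> t = t [^] n" using n nat_pow_Suc[of t "n - 1"] by simp
    ultimately have "t [^] n \<in> J" by simp
    moreover have "\<ominus> (t [^] n \<ominus> \<one>) \<in> K" using K(3) by simp
    moreover have "t [^] n \<oplus> \<ominus> (t [^] n \<ominus> \<one>) = \<one>"
    proof -
      have "t [^] n \<in> carrier R" using t by simp
      then show ?thesis by algebra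
    qed
    ultimately have com: "\<exists>a\<in>J. \<exists>b\<in>K. a \<oplus> b = \<one>" by (intro bexI)
    have bigK: "\<not> small_on R (max_above R K)" using bigu unfolding K(4) .
    have "small_on R (max_above R J)"
    proof (rule ccontr)
      assume bigJ: "\<not> small_on R (max_above R J)"
      have ?split
        by (rule exI[of _ J], rule exI[of _ K], intro conjI) (fact J(1,2) K(1,2) bigJ bigK com)+
      then show False using unsplit by blast
    qed
    then show ?thesis unfolding J(4) .
  qed
  have NC: "N \<subseteq> carrier R" unfolding N_def by blast
  have sub_N: "r \<in> N" if "r \<in> carrier R" "D r \<subseteq> D a \<union> D b" "a \<in> N" "b \<in> N" for r a b
    using that small_on_Un small_on_mono unfolding N_def by blast
  have in_N: "r \<in> N" if "r \<in> carrier R" "D r = {}" for r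
    using that small_on_empty unfolding N_def by simp
  have DI: "D r \<subseteq> D a" if "\<And>M. M \<in> Y \<Longrightarrow> a \<in> M \<Longrightarrow> r \<in> M" for r a using that unfolding D_def by blast
  have N: "ideal N R"
  proof (rule idealI'[OF NC])
    show "\<zero> \<in> N"
      using additive_subgroup.zero_closed[OF ideal.axioms(1)[OF YI]] by (intro in_N) (auto simp: D_def)
    fix a assume a: "a \<in> N"
    show "a \<oplus> b \<in> N" if b: "b \<in> N" for b
    proof (rule sub_N[OF _ _ a b])
      show "a \<oplus> b \<in> carrier R" using a b NC by auto
      show "D (a \<oplus> b) \<subseteq> D a \<union> D b"
        using additive_subgroup.a_closed[OF ideal.axioms(1)[OF YI]] unfolding D_def by blast
    qed
    fix r assume r: "r \<in> carrier R"
    show "r \<otimes> a \<in> N"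
    proof (rule sub_N[OF _ _ a a])
      show "r \<otimes> a \<in> carrier R" using a r NC by auto
      show "D (r \<otimes> a) \<subseteq> D a \<union> D a" using DI[of a "r \<otimes> a"] ideal.I_l_closed[OF YI _ r] by blast
    qed
    then show "a \<otimes> r \<in> N" using a r NC m_comm[of a r] by auto
  qed
  have "\<one> \<notin> N"
  proof
    assume "\<one> \<in> N"
    moreover have "D \<one> = Y"
      using maximalideal.I_notcarr[OF YM(1)] ideal.one_imp_carrier[OF YI] unfolding D_def by blast
    ultimately show False using big unfolding N_def Y_def by simp
  qed
  then obtain M0 where M0: "maximalideal M0 R" "N \<subseteq> M0" using exists_maximal_ideal_above[OF N] by blast
  interpret M0: maximalideal M0 R by fact
  \<comment> \<open>For t outside N some u = t^n - 1 vanishes on a set that is not small. If u were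
    outside N as well, the same dichotomy applied to u would make that set small. So t^n is 1 modulo
    N, which is impossible for t in \<open>M0\<close>.\<close>
  have "M0 \<subseteq> N"
  proof
    fix t assume t: "t \<in> M0"
    show "t \<in> N"
    proof (rule ccontr)
      assume tN: "t \<notin> N"
      have tc: "t \<in> carrier R" using t M0.Icarr by blast
      obtain n :: nat where n: "n > 0" "\<not> small_on R {M \<in> Y. t [^] n \<ominus> \<one> \<in> M}" using dich[OF tc tN] by blast
      define u where "u = t [^] n \<ominus> \<one>"
      have uc: "u \<in> carrier R" unfolding u_def using tc by simp
      have "u \<in> N"
      proof (rule ccontr)
        assume "u \<notin> N"
        then obtain k :: nat where "k > 0" "\<not> small_on R {M \<in> Y. u [^] k \<ominus> \<one> \<in> M}" using dich[OF uc] by blast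
        from smallV[OF uc this] show False using n(2) unfolding u_def by simp
      qed
      then have "u \<in> M0" using M0(2) by blast
      moreover have "t [^] (n - 1) \<otimes> t \<in> M0" using M0.I_l_closed[OF t] tc by simp
      then have "t [^] n \<in> M0" using n(1) nat_pow_Suc[of t "n - 1"] by simp
      ultimately have "t [^] n \<oplus> \<ominus> u \<in> M0" by simp
      moreover have "t [^] n \<oplus> \<ominus> u = \<one>"
      proof -
        have "t [^] n \<in> carrier R" using tc by simp
        then show ?thesis unfolding u_def by algebra
      qed
      ultimately show False using M0.one_imp_carrier M0.I_notcarr by simp
    qed
  qed
  then have NM: "maximalideal N R" using M0 by (metis subset_antisym)
  interpret N: maximalideal N R by fact
  have "\<exists>e. e \<in> N \<and> e \<notin> M" if "M \<in> Y - {N}" for M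
    using maximalideal_unique[OF NM YM(1)[of M]] that by blast
  then obtain e where e: "\<And>M. M \<in> Y - {N} \<Longrightarrow> e M \<in> N \<and> e M \<notin> M" by metis
  have cover: "\<exists>A. set A \<subseteq> Y - {N} \<and> D x \<subseteq> (\<Union>M\<in>set A. D (e M))" if x: "x \<in> N" for x
  proof -
    \<comment> \<open>H contains I and every \<open>e M\<close>, so a maximal ideal above it can
      only be N. The Hilbert property puts a power of x into H, and x vanishes wherever that power
      does.\<close>
    define H where "H = {z \<in> carrier R. \<exists>A. set A \<subseteq> Y - {N} \<and> D z \<subseteq> (\<Union>M\<in>set A. D (e M))}"
    have H: "ideal H R"
    proof (rule idealI')
      show "H \<subseteq> carrier R" unfolding H_def by blast
      have "D \<zero> = {}"
        using additive_subgroup.zero_closed[OF ideal.axioms(1)[OF YI]] unfolding D_def by blast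
      then show "\<zero> \<in> H" unfolding H_def by (auto intro!: exI[of _ "[]"])
      fix a assume a: "a \<in> H"
      then obtain A where A: "a \<in> carrier R" "set A \<subseteq> Y - {N}" "D a \<subseteq> (\<Union>M\<in>set A. D (e M))"
        unfolding H_def by blast
      show "a \<oplus> b \<in> H" if "b \<in> H" for b
      proof -
        obtain B where B: "b \<in> carrier R" "set B \<subseteq> Y - {N}" "D b \<subseteq> (\<Union>M\<in>set B. D (e M))"
          using \<open>b \<in> H\<close> unfolding H_def by blast
        have "D (a \<oplus> b) \<subseteq> D a \<union> D b"
          using additive_subgroup.a_closed[OF ideal.axioms(1)[OF YI]] unfolding D_def by blast
        also have "\<dots> \<subseteq> (\<Union>M\<in>set (A @ B). D (e M))" using A(3) B(3) by auto
        finally have "D (a \<oplus> b) \<subseteq> (\<Union>M\<in>set (A @ B). D (e M))" .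
        moreover have "set (A @ B) \<subseteq> Y - {N}" using A(2) B(2) by simp
        ultimately show ?thesis unfolding H_def using A(1) B(1) by blast
      qed
      fix r assume r: "r \<in> carrier R"
      have "D (r \<otimes> a) \<subseteq> D a" using DI[of a "r \<otimes> a"] ideal.I_l_closed[OF YI _ r] by blast
      then show "r \<otimes> a \<in> H" unfolding H_def using A r by blast
      then show "a \<otimes> r \<in> H" using A(1) r m_comm by simp
    qed
    have xc: "x \<in> carrier R" using x NC by blast
    have "x \<in> M" if M: "maximalideal M R" "H \<subseteq> M" for M
    proof -
      have "z \<in> H" if z: "z \<in> I" for z
      proof -
        have "D z = {}" using z YM(2) unfolding D_def by blast
        moreover have "z \<in> carrier R" using z ideal.Icarr[OF I] by blast
        ultimately show ?thesis unfolding H_def by (auto intro!: exI[of _ "[]"])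
      qed
      then have MY: "M \<in> Y" using M unfolding Y_def Max_ideals_def by blast
      have "M = N"
      proof (rule ccontr)
        assume "M \<noteq> N"
        then have eM: "e M \<in> N" "e M \<notin> M" using e MY by auto
        have "set [M] \<subseteq> Y - {N}" using MY \<open>M \<noteq> N\<close> by simp
        moreover have "D (e M) \<subseteq> (\<Union>M\<in>set [M]. D (e M))" by simp
        moreover have "e M \<in> carrier R" using eM(1) NC by blast
        ultimately have "e M \<in> H" unfolding H_def by blast
        then show False using M(2) eM(2) by blast
      qed
      then show ?thesis using x by simp
    qed
    then obtain k :: nat where "x [^] k \<in> H"
      using power_in_ideal_if_in_maximal_ideals[OF no xc H] by blast
    then obtain A where A: "set A \<subseteq> Y - {N}" "D (x [^] k) \<subseteq> (\<Union>M\<in>set A. D (e M))" unfolding H_def by blast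
    have pow: "x [^] j \<in> M \<Longrightarrow> x \<in> M" if M: "M \<in> Y" for M and j :: nat
    proof (induct j)
      case 0
      then show ?case using maximalideal.I_notcarr[OF YM(1)[OF M]] ideal.one_imp_carrier[OF YI[OF M]] by simp
    next
      case (Suc j)
      have "primeideal M R" by (rule maximalideal_prime[OF YM(1)[OF M]])
      then show ?case using Suc xc primeideal.I_prime[of M R "x [^] j" x] by auto
    qed
    have "D x \<subseteq> D (x [^] k)" using pow unfolding D_def by blast
    then show ?thesis using A by blast
  qed
  define A where "A x = (SOME A. set A \<subseteq> Y - {N} \<and> D x \<subseteq> (\<Union>M\<in>set A. D (e M)))" for x
  have A: "set (A x) \<subseteq> Y - {N} \<and> D x \<subseteq> (\<Union>M\<in>set (A x). D (e M))" if "x \<in> N" for x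
    unfolding A_def by (rule someI_ex[OF cover[OF that]])
  have "small_on R (\<Union>M\<in>set L. D (e M))" if "set L \<subseteq> Y - {N}" for L
  proof (rule small_on_countable_Union)
    show "countable ((\<lambda>M. D (e M)) ` set L)" by (simp add: countable_finite)
    fix Z assume "Z \<in> (\<lambda>M. D (e M)) ` set L"
    then obtain M where "M \<in> set L" "Z = D (e M)" by blast
    moreover from this have "e M \<in> N" using that e by blast
    ultimately show "small_on R Z" unfolding N_def by blast
  qed
  then have "\<exists>\<phi> :: 'a \<Rightarrow> nat set. set L \<subseteq> Y - {N} \<longrightarrow> (\<forall>a\<in>carrier R. \<forall>b\<in>carrier R.
      \<phi> a = \<phi> b \<longrightarrow> (\<forall>M\<in>(\<Union>M\<in>set L. D (e M)). a \<ominus> b \<in> M))" for L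
    unfolding small_on_def by blast
  then obtain \<phi> :: "'a set list \<Rightarrow> 'a \<Rightarrow> nat set" where
    \<phi>: "\<And>L. set L \<subseteq> Y - {N} \<longrightarrow> (\<forall>a\<in>carrier R. \<forall>b\<in>carrier R.
      \<phi> L a = \<phi> L b \<longrightarrow> (\<forall>M\<in>(\<Union>M\<in>set L. D (e M)). a \<ominus> b \<in> M))" by metis
  obtain g where g: "separates_cosets R N g" using exists_separating_map[OF no NM] by blast
  \<comment> \<open>The representative depends only on the number of the residue at N, so two
    elements with equal codes are shifted into N by the same amount.\<close>
  define \<rho> where "\<rho> n = (SOME r. r \<in> carrier R \<and> g r = n)" for n
  have \<rho>: "\<rho> (g a) \<in> carrier R" "a \<ominus> \<rho> (g a) \<in> N" if a: "a \<in> carrier R" for a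
  proof -
    have "\<rho> (g a) \<in> carrier R \<and> g (\<rho> (g a)) = g a"
      unfolding \<rho>_def by (rule someI[where x = a]) (use a in simp)
    then show "\<rho> (g a) \<in> carrier R" "a \<ominus> \<rho> (g a) \<in> N"
      using separates_cosetsD[OF g a, of "\<rho> (g a)"] by auto
  qed
  obtain j :: "'a set \<Rightarrow> nat set" where j: "inj_on j (Max_ideals R)"
    using Max_ideals_lepoll[OF no] unfolding lepoll_def by blast
  \<comment> \<open>The code consists of the residue of a at N, the code of z on the finite union
    where z may be nonzero, and the list of maximal ideals naming that union.\<close>
  define \<Phi> where "\<Phi> a = (let z = a \<ominus> \<rho> (g a) in encode_list ({g a} # \<phi> (A z) z # map j (A z)))" for a
  have "small_on R Y"
  proof (rule small_onI[where \<phi> = \<Phi>])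
    fix a b M assume a: "a \<in> carrier R" and b: "b \<in> carrier R" and eq: "\<Phi> a = \<Phi> b" and M: "M \<in> Y"
    define r where "r = \<rho> (g a)"
    define z w where "z = a \<ominus> r" and "w = b \<ominus> r"
    have gab: "g a = g b" using eq unfolding \<Phi>_def Let_def encode_list_inject by simp
    have rc: "r \<in> carrier R" and zN: "z \<in> N" and wN: "w \<in> N"
      using \<rho>[OF a] \<rho>[OF b] gab unfolding r_def z_def w_def by auto
    have zc: "z \<in> carrier R" "w \<in> carrier R" using zN wN NC by auto
    have "\<phi> (A z) z = \<phi> (A w) w" "map j (A z) = map j (A w)"
      using eq gab unfolding \<Phi>_def Let_def encode_list_inject z_def w_def r_def by auto
    moreover have "inj_on j (set (A z) \<union> set (A w))"
      by (rule inj_on_subset[OF j]) (use A[OF zN] A[OF wN] YM(3) in blast)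
    ultimately have AA: "A z = A w" "\<phi> (A z) z = \<phi> (A z) w"
      using inj_on_map_eq_map[of j "A z" "A w"] by simp_all
    have "z \<ominus> w \<in> M"
    proof (cases "M \<in> (\<Union>M\<in>set (A z). D (e M))")
      case True
      then show ?thesis using \<phi>[of "A z"] A[OF zN] AA(2) zc by blast
    next
      \<comment> \<open>Outside the common union both z and w vanish at M.\<close>
      case False
      then have "z \<in> M" "w \<in> M" using A[OF zN] A[OF wN] AA(1) M unfolding D_def by auto
      interpret M: ideal M R by (rule YI[OF M])
      show ?thesis using \<open>z \<in> M\<close> \<open>w \<in> M\<close> by (simp add: minus_eq)
    qed
    moreover have "z \<ominus> w = a \<ominus> b" unfolding z_def w_def using a b rc by algebra
    ultimately show "a \<ominus> b \<in> M" by simp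
  qed
  then show False using big unfolding Y_def by blast
qed

section \<open>The Cantor tree and the cardinality conclusions\<close>

lemma (in cring) continuum_lepoll_Max_ideals:
  assumes no: "\<not> (\<exists>S. maximal_subring S R)" and big: "\<not> small_on R (Max_ideals R)"
  shows "lepoll (UNIV :: nat set set) (Max_ideals R)"
proof -
  define good where "good I \<longleftrightarrow> ideal I R \<and> \<not> small_on R (max_above R I)" for I
  have "\<exists>J K. good I \<longrightarrow> good J \<and> good K \<and> I \<subseteq> J \<and> I \<subseteq> K \<and> (\<exists>m\<in>J. \<exists>n\<in>K. m \<oplus> n = \<one>)" for I
    using split_not_small[OF no, of I] unfolding good_def by blast
  then obtain l r where lr: "\<And>I. good I \<Longrightarrow> good (l I) \<and> good (r I) \<and> I \<subseteq> l I \<and> I \<subseteq> r I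
      \<and> (\<exists>m\<in>l I. \<exists>n\<in>r I. m \<oplus> n = \<one>)" by metis
  \<comment> \<open>A set S of numbers is read as a branch, which turns to \<open>l\<close> at level
    n exactly when n belongs to S.\<close>
  define T where "T S = rec_nat {\<zero>} (\<lambda>n I. if n \<in> S then l I else r I)" for S :: "nat set"
  have T0: "T S 0 = {\<zero>}" and TSuc: "T S (Suc n) = (if n \<in> S then l (T S n) else r (T S n))" for S n
    unfolding T_def by simp_all
  have "max_above R {\<zero>} = Max_ideals R"
    using additive_subgroup.zero_closed[OF ideal.axioms(1)[OF maximalideal.axioms(1)]]
    unfolding Max_ideals_def by blast
  then have "good {\<zero>}" unfolding good_def using zeroideal big by simp
  then have good: "good (T S n)" for S n by (induct n) (auto simp: T0 TSuc lr)
  have mono: "T S n \<subseteq> T S (Suc n)" for S n using lr[OF good] by (auto simp: TSuc)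
  have "\<exists>M. maximalideal M R \<and> (\<forall>n. T S n \<subseteq> M)" for S
  proof -
    have le: "T S n \<subseteq> T S m" if "n \<le> m" for n m by (rule lift_Suc_mono_le[of "T S", OF mono that])
    have ch: "subset.chain {I. ideal I R} (range (T S))"
      unfolding subset_chain_def
    proof (intro conjI ballI)
      show "range (T S) \<subseteq> {I. ideal I R}" using good unfolding good_def by blast
      fix A B assume "A \<in> range (T S)" "B \<in> range (T S)"
      then obtain n m where "A = T S n" "B = T S m" by blast
      then show "A \<subseteq> B \<or> B \<subseteq> A" using le[of n m] le[of m n] linear[of n m] by blast
    qed
    have "ideal (\<Union>(range (T S))) R" using chain_Union_is_ideal[OF ch] by simp
    \<comment> \<open>A node containing 1 has no maximal ideal above it, and the empty set is
      small.\<close>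
    moreover have "\<one> \<notin> \<Union>(range (T S))"
    proof
      assume "\<one> \<in> \<Union>(range (T S))"
      then obtain n where n: "\<one> \<in> T S n" by blast
      have empty: "max_above R (T S n) = {}"
      proof -
        have False if "M \<in> max_above R (T S n)" for M
        proof -
          interpret M: maximalideal M R using that unfolding Max_ideals_def by simp
          show False using that n M.one_imp_carrier M.I_notcarr by blast
        qed
        then show ?thesis by blast
      qed
      have "\<not> small_on R (max_above R (T S n))" using good[of S n] unfolding good_def by blast
      then show False unfolding empty using small_on_empty by blast
    qed
    ultimately obtain M where "maximalideal M R" "\<Union>(range (T S)) \<subseteq> M"
      using exists_maximal_ideal_above by blast
    then show ?thesis by blast
  qed
  then obtain M where M: "\<And>S. maximalideal (M S) R" "\<And>S n. T S n \<subseteq> M S" by metis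
  have "inj M"
  proof (rule injI, rule ccontr)
    fix S S' assume eq: "M S = M S'" and "S \<noteq> S'"
    \<comment> \<open>Up to level n the branches share their nodes; a common maximal ideal would
      contain both comaximal children of the last shared node.\<close>
    define n where "n = (LEAST n. (n \<in> S) \<noteq> (n \<in> S'))"
    have n: "(n \<in> S) \<noteq> (n \<in> S')"
      unfolding n_def by (rule LeastI_ex) (use \<open>S \<noteq> S'\<close> in blast)
    have below: "k \<in> S \<longleftrightarrow> k \<in> S'" if "k < n" for k
      using not_less_Least[of k "\<lambda>n. (n \<in> S) \<noteq> (n \<in> S')"] that unfolding n_def by blast
    have "k \<le> n \<Longrightarrow> T S k = T S' k" for k by (induct k) (auto simp: T0 TSuc below)
    then have "T S n = T S' n" by simp
    then have "l (T S n) \<subseteq> M S" "r (T S n) \<subseteq> M S"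
      using M(2)[of S "Suc n"] M(2)[of S' "Suc n"] n eq by (auto simp: TSuc split: if_splits)
    moreover obtain a b where "a \<in> l (T S n)" "b \<in> r (T S n)" "a \<oplus> b = \<one>" using lr[OF good] by blast
    ultimately have ab: "a \<in> M S" "b \<in> M S" "a \<oplus> b = \<one>" by auto
    interpret M: maximalideal "M S" R by (rule M(1))
    have "\<one> \<in> M S" using M.a_closed[OF ab(1,2)] ab(3) by simp
    then show False using M.one_imp_carrier M.I_notcarr by simp
  qed
  then show ?thesis unfolding lepoll_def using M(1) unfolding Max_ideals_def by blast
qed

text \<open>When the members of Y separate elements, a code for Y is injective on R, against
  Cantor's theorem. Needed for all maximal ideals, to start the tree, and for a countable
  family.\<close>

lemma (in cring) not_small_on_if_trivial_intersection:
  assumes "carrier R \<approx> (UNIV :: nat set set set)"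
    and "\<And>a. a \<in> carrier R \<Longrightarrow> (\<And>M. M \<in> Y \<Longrightarrow> a \<in> M) \<Longrightarrow> a = \<zero>"
  shows "\<not> small_on R Y"
proof
  assume "small_on R Y"
  then obtain \<phi> :: "'a \<Rightarrow> nat set" where
    \<phi>: "\<forall>a\<in>carrier R. \<forall>b\<in>carrier R. \<phi> a = \<phi> b \<longrightarrow> (\<forall>M\<in>Y. a \<ominus> b \<in> M)"
    unfolding small_on_def by blast
  have "inj_on \<phi> (carrier R)"
  proof (rule inj_onI)
    fix a b assume ab: "a \<in> carrier R" "b \<in> carrier R" "\<phi> a = \<phi> b"
    have "a \<ominus> b = \<zero>" by (rule assms(2)) (use ab \<phi> in auto)
    then show "a = b" using ab by simp
  qed
  then have "lepoll (carrier R) (UNIV :: nat set set)" unfolding lepoll_def by blast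
  then have "lepoll (UNIV :: nat set set set) (UNIV :: nat set set)"
    using assms(1) eqpoll_sym lepoll_trans1 by blast
  moreover have "(UNIV :: nat set set) \<prec> (UNIV :: nat set set set)"
    using lesspoll_Pow_self[of "UNIV :: nat set set"] by simp
  ultimately show False using lepoll_antisym lesspoll_def by blast
qed

theorem theorem2p23:
  fixes T :: "('a, 'b) ring_scheme"
  assumes "cring T" and "\<one>\<^bsub>T\<^esub> \<noteq> \<zero>\<^bsub>T\<^esub>"
    and "reduced_ring T"
    and "carrier T \<approx> (UNIV :: nat set set set)"
  shows "(\<exists>S. maximal_subring S T) \<or>
         (Max_ideals T \<approx> (UNIV :: nat set set) \<and>
          (\<forall>F. countable F \<and> F \<subseteq> Max_ideals T \<longrightarrow> \<Inter>F \<noteq> {\<zero>\<^bsub>T\<^esub>}))"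
proof (rule disj_imp[THEN iffD2], rule impI)
  assume no: "\<not> (\<exists>S. maximal_subring S T)"
  interpret cring T by fact
  have "\<not> small_on T (Max_ideals T)"
  proof (rule not_small_on_if_trivial_intersection[OF assms(4)])
    fix a assume a: "a \<in> carrier T" "\<And>M. M \<in> Max_ideals T \<Longrightarrow> a \<in> M"
    \<comment> \<open>The Hilbert property of the zero ideal shows that an element of every maximal
      ideal is nilpotent.\<close>
    then obtain n :: nat where "a [^]\<^bsub>T\<^esub> n = \<zero>\<^bsub>T\<^esub>"
      using power_in_ideal_if_in_maximal_ideals[OF no a(1) zeroideal] unfolding Max_ideals_def by auto
    then show "a = \<zero>\<^bsub>T\<^esub>" using assms(3) a(1) unfolding reduced_ring_def by blast
  qed
  then have "Max_ideals T \<approx> (UNIV :: nat set set)"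
    using Max_ideals_lepoll[OF no] continuum_lepoll_Max_ideals[OF no] lepoll_antisym by blast
  moreover have "\<Inter>F \<noteq> {\<zero>\<^bsub>T\<^esub>}" if F: "countable F" "F \<subseteq> Max_ideals T" for F
  proof
    assume zero: "\<Inter>F = {\<zero>\<^bsub>T\<^esub>}"
    \<comment> \<open>Residue fields are countable, so singletons are small, and with them every
      countable family.\<close>
    have "small_on T {M}" if "M \<in> F" for M
      using exists_separating_map[OF no] small_on_singleton that F(2) unfolding Max_ideals_def by blast
    then have "small_on T (\<Union>((\<lambda>M. {M}) ` F))"
      using F(1) by (intro small_on_countable_Union) auto
    moreover have "\<not> small_on T F"
      by (rule not_small_on_if_trivial_intersection[OF assms(4)]) (use zero in blast)
    ultimately show False by simp
  qed
  ultimately show "Max_ideals T \<approx> (UNIV :: nat set set) \<and>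
      (\<forall>F. countable F \<and> F \<subseteq> Max_ideals T \<longrightarrow> \<Inter>F \<noteq> {\<zero>\<^bsub>T\<^esub>})" by blast
qed

end
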